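(* Let $\mathcal{T}$ be a non-trivial hereditary property of binary matroids. Then the following are equivalent: (a) $\mathcal{T}$ is thin, i.e. $\chi_c(\mathcal{T})=0$; (b) there exists an affine pattern $A$ such that every matroid in $\mathcal{T}$ is $A$-free; (c) $h(n,\mathcal{T})=o(2^n)$ as $n\to\infty$.
   Context: A binary projective space is a set $V=W\setminus\{0\}$ where $W$ is a finite-dimensional $\mathbb{F}_2$-vector space; its dimension $\dim(V)$ is defined to be $\dim_{\mathbb{F}_2}(W)$. A subspace of $V$ is a set $U\setminus\{0\}$ with $U$ a linear subspace of $W$; codimension is $\dim(V)-\dim(U)$. A linear injection between binary projective spaces is the restriction of an injective linear map of the underlying vector spaces. A (simple binary) matroid is a function $M:V(M)\to\{0,1\}$ with $V(M)$ a binary projective space, and $\dim(M)=\dim(V(M))$. For a subspace $U$, $M[U]$ denotes the restriction of $M$ to $U$. Matroids $M_1,M_2$ are isomorphic if $M_1=M_2\circ\phi$ for an invertible linear map $\phi$. A matroid property is a set of matroids closed under isomorphism; it is hereditary if it is closed under restriction to subspaces, and non-trivial if it contains matroids of arbitrarily large dimension. For a property $\mathcal{P}$, $\mathcal{P}^n$ is the set of matroids in $\mathcal{P}$ on $\mathbb{F}_2^n\setminus\{0\}$, and $h(n,\mathcal{P})=\log_2|\mathcal{P}^n|$. For $k\ge 0$, $\mathrm{Ext}^k(M)$ is the set of matroids $M'$ with $\dim(M')\le \dim(M)+k$ such that $M$ is (isomorphic to) the restriction of $M'$ to a subspace of codimension at most $k$ in $V(M')$; $\mathrm{Ext}^k(\mathcal{P})=\bigcup_{M\in\mathcal{P}}\mathrm{Ext}^k(M)$.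 Let $\mathcal{O}$ (resp. $\mathcal{I}$) be the property of all identically $0$ (resp. identically $1$) matroids, and $\mathcal{M}(k,0)=\mathrm{Ext}^k(\mathcal{O})$, $\mathcal{M}(k,1)=\mathrm{Ext}^k(\mathcal{I})$. The critical number $\chi_c(\mathcal{P})$ of a non-trivial hereditary property $\mathcal{P}$ is the maximum integer $k\ge0$ such that $\mathcal{M}(k,i)\subseteq\mathcal{P}$ for some $i\in\{0,1\}$; $\mathcal{P}$ is thin if $\chi_c(\mathcal{P})=0$. A pattern is a function $N:V(N)\to\{0,1,\star\}$ with $V(N)$ a binary projective space. For a pattern $N$ and a pattern or matroid $M$, an $N$-instance in $M$ is a linear injection $\phi:V(N)\to V(M)$ with $M(\phi(x))=N(x)$ for every $x$ with $N(x)\in\{0,1\}$. $M$ is $N$-free if there is no $N$-instance in $M$. For an integer $k\ge1$, a pattern $A$ is $k$-affine if $A^{-1}(\star)$ is a subspace of codimension $k$ in $V(A)$; an affine pattern is a $1$-affine pattern. *)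

theory Defs
  imports
    Complex_Main
    "HOL-Library.Z2"
    "HOL-Library.Function_Algebras"
    "HOL-Library.Landau_Symbols"
begin

section \<open>Binary projective spaces\<close>

text \<open>
  The ambient type is a vector space of infinite dimension over the field of two elements
  (type \<^typ>\<open>bit\<close>), with pointwise operations. Each finite-dimensional vector space over that
  field is isomorphic to a subspace of it, and all notions below are invariant under isomorphism.
\<close>

type_synonym f2vec = "nat \<Rightarrow> bit"

definition f2scale :: "bit \<Rightarrow> f2vec \<Rightarrow> f2vec" where
  "f2scale c v = (\<lambda>i. c * v i)"

global_interpretation f2: vector_space f2scale
  by unfold_locales (auto simp: f2scale_def fun_eq_iff algebra_simps)

definition proj_space :: "f2vec set \<Rightarrow> bool" where
  "proj_space V \<longleftrightarrow>
    (\<exists>W. f2.subspace W \<and> (\<exists>B. finite B \<and> f2.span B = W) \<and> V = W - {0})"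

definition pdim :: "f2vec set \<Rightarrow> nat" where
  "pdim V = f2.dim (insert 0 V)"

definition proj_subspace :: "f2vec set \<Rightarrow> f2vec set \<Rightarrow> bool" where
  "proj_subspace U V \<longleftrightarrow> proj_space U \<and> U \<subseteq> V"

text \<open>Only used for subspaces \<open>U\<close> of \<open>V\<close>, where the subtraction of naturals does not truncate.\<close>

definition codim :: "f2vec set \<Rightarrow> f2vec set \<Rightarrow> nat" where
  "codim U V = pdim V - pdim U"

text \<open>The values of \<open>\<phi>\<close> outside \<open>insert 0 V\<close> are irrelevant.\<close>

definition linear_injection :: "(f2vec \<Rightarrow> f2vec) \<Rightarrow> f2vec set \<Rightarrow> f2vec set \<Rightarrow> bool" where
  "linear_injection \<phi> V V' \<longleftrightarrow>
    \<phi> ` insert 0 V \<subseteq> insert 0 V' \<and>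
    (\<forall>x\<in>insert 0 V. \<forall>y\<in>insert 0 V. \<phi> (x + y) = \<phi> x + \<phi> y) \<and>
    (\<forall>c. \<forall>x\<in>insert 0 V. \<phi> (f2scale c x) = f2scale c (\<phi> x)) \<and>
    inj_on \<phi> (insert 0 V)"

text \<open>The binary projective space of all nonzero vectors of the standard space of dimension \<open>n\<close>.\<close>

definition std_space :: "nat \<Rightarrow> f2vec set" where
  "std_space n = {v. \<forall>i\<ge>n. v i = 0} - {0}"


section \<open>Matroids\<close>

text \<open>
  A matroid is a partial map whose domain is the projective space on which it is defined, so
  that functions on a given projective space are represented uniquely, and the library operation
  \<open>M |` U\<close> is the restriction of \<open>M\<close> to a subspace \<open>U\<close>.
\<close>

type_synonym matroid = "f2vec \<rightharpoonup> bit"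

definition is_matroid :: "matroid \<Rightarrow> bool" where
  "is_matroid M \<longleftrightarrow> proj_space (dom M)"

definition mdim :: "matroid \<Rightarrow> nat" where
  "mdim M = pdim (dom M)"

definition isomorphic :: "matroid \<Rightarrow> matroid \<Rightarrow> bool" where
  "isomorphic M M' \<longleftrightarrow>
    (\<exists>\<phi>. linear_injection \<phi> (dom M) (dom M') \<and> \<phi> ` dom M = dom M' \<and>
         (\<forall>x\<in>dom M. M x = M' (\<phi> x)))"

definition matroid_property :: "matroid set \<Rightarrow> bool" where
  "matroid_property P \<longleftrightarrow>
    (\<forall>M\<in>P. is_matroid M) \<and>
    (\<forall>M\<in>P. \<forall>M'. is_matroid M' \<and> isomorphic M M' \<longrightarrow> M' \<in> P)"

definition hereditary :: "matroid set \<Rightarrow> bool" where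
  "hereditary P \<longleftrightarrow> (\<forall>M\<in>P. \<forall>U. proj_subspace U (dom M) \<longrightarrow> M |` U \<in> P)"

definition nontrivial :: "matroid set \<Rightarrow> bool" where
  "nontrivial P \<longleftrightarrow> (\<forall>d. \<exists>M\<in>P. mdim M \<ge> d)"

definition slice :: "matroid set \<Rightarrow> nat \<Rightarrow> matroid set" where
  "slice P n = {M \<in> P. dom M = std_space n}"

definition h :: "nat \<Rightarrow> matroid set \<Rightarrow> real" where
  "h n P = log 2 (real (card (slice P n)))"


section \<open>Extensions and the critical number\<close>

definition Ext :: "nat \<Rightarrow> matroid \<Rightarrow> matroid set" where
  "Ext k M = {M'. is_matroid M' \<and> mdim M' \<le> mdim M + k \<and>
    (\<exists>U. proj_subspace U (dom M') \<and> codim U (dom M') \<le> k \<and> isomorphic M (M' |` U))}"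

definition Ext_property :: "nat \<Rightarrow> matroid set \<Rightarrow> matroid set" where
  "Ext_property k P = (\<Union>M\<in>P. Ext k M)"

definition const_matroids :: "bit \<Rightarrow> matroid set" where
  "const_matroids i = {M. is_matroid M \<and> (\<forall>x\<in>dom M. M x = Some i)}"

definition ext_const :: "nat \<Rightarrow> bit \<Rightarrow> matroid set" where
  "ext_const k i = Ext_property k (const_matroids i)"

text \<open>
  The critical number is a maximum, which does not exist if \<open>P\<close> is the property of all matroids;
  hence it is given as a relation, which determines \<open>k\<close> uniquely.
\<close>

definition is_critical_number :: "matroid set \<Rightarrow> nat \<Rightarrow> bool" where
  "is_critical_number P k \<longleftrightarrow>
    (\<exists>i. ext_const k i \<subseteq> P) \<and> (\<forall>k'. (\<exists>i. ext_const k' i \<subseteq> P) \<longrightarrow> k' \<le> k)"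

definition thin :: "matroid set \<Rightarrow> bool" where
  "thin P \<longleftrightarrow> is_critical_number P 0"


section \<open>Patterns\<close>

datatype pattern_value = Val bit | Star

type_synonym pattern = "f2vec \<rightharpoonup> pattern_value"

definition is_pattern :: "pattern \<Rightarrow> bool" where
  "is_pattern N \<longleftrightarrow> proj_space (dom N)"

definition is_instance :: "pattern \<Rightarrow> matroid \<Rightarrow> (f2vec \<Rightarrow> f2vec) \<Rightarrow> bool" where
  "is_instance N M \<phi> \<longleftrightarrow>
    linear_injection \<phi> (dom N) (dom M) \<and>
    (\<forall>x b. N x = Some (Val b) \<longrightarrow> M (\<phi> x) = Some b)"

definition pattern_free :: "pattern \<Rightarrow> matroid \<Rightarrow> bool" where
  "pattern_free N M \<longleftrightarrow> (\<nexists>\<phi>. is_instance N M \<phi>)"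

text \<open>The subspace of stars may be empty (of dimension 0).\<close>

definition k_affine :: "nat \<Rightarrow> pattern \<Rightarrow> bool" where
  "k_affine k A \<longleftrightarrow>
    k \<ge> 1 \<and> is_pattern A \<and>
    proj_subspace {x. A x = Some Star} (dom A) \<and>
    codim {x. A x = Some Star} (dom A) = k"

definition affine_pattern :: "pattern \<Rightarrow> bool" where
  "affine_pattern A \<longleftrightarrow> k_affine 1 A"

end

theory Submission
  imports Defs
begin

text \<open>
  The engine is that a dense subset of a finite space contains a coset of a large subspace (shift
  the set by a popular difference, iterate). Applied to the colour classes of a 2-colouring, it
  yields a coset \<open>x + U\<close> of one colour, and recursion inside \<open>U\<close> produces a large monochromatic
  subspace; so a non-trivial hereditary property contains all constant matroids of one value.

  If the property is thin, it omits some matroid constant with value \<open>i\<close> on a hyperplane for each of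
  \<open>i = 0, 1\<close>. An affine pattern whose affine part contains every function on every small subspace
  cannot occur then: a monochromatic subspace of its hyperplane, of value \<open>i\<close> say, and a suitable
  coset form a copy of the omitted matroid for \<open>i\<close>. Conversely, if the property is free of an affine
  pattern, then its matroids on a given space, viewed as a set system, shatter no coset (off 0) of a
  subspace of a certain dimension, so they shatter only sets of density \<open>o(1)\<close>; there are at least as
  many shattered sets as members of the system, hence only \<open>2 ^ o(2 ^ n)\<close> members. Finally, if the
  property contains all matroids constant on a hyperplane, neither (b) nor (c) holds.
\<close>

section \<open>Finite vector spaces over the field of two elements\<close>

lemma f2_add_self [simp]: "(x :: f2vec) + x = 0"
  by (auto simp: fun_eq_iff)

lemma f2_add_cancel [simp]: "(x :: f2vec) + (x + y) = y"
  by (simp flip: add.assoc)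

lemma f2_eq_add_iff: "(x :: f2vec) = a + y \<longleftrightarrow> a + x = y"
  by (metis f2_add_cancel)

lemma f2scale_cases: "f2scale c x = (if c = 0 then 0 else x)"
  by (cases c) (auto simp: f2scale_def fun_eq_iff)

lemma f2_subspace_iff: "f2.subspace W \<longleftrightarrow> 0 \<in> W \<and> (\<forall>x\<in>W. \<forall>y\<in>W. x + y \<in> W)"
  by (auto simp: f2.subspace_def f2scale_cases)

lemma f2_span_insert: "f2.span (insert a B) = f2.span B \<union> (+) a ` f2.span B"
proof -
  have "(\<exists>k. x - f2scale k a \<in> f2.span B) \<longleftrightarrow> x \<in> f2.span B \<or> a + x \<in> f2.span B" for x
  proof -
    have 1: "x - a = a + x"
      by (metis diff_eq_eq add.commute f2_add_cancel)
    have 2: "(\<exists>k. x - f2scale k a \<in> f2.span B) \<longleftrightarrow>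
        x - f2scale 0 a \<in> f2.span B \<or> x - f2scale 1 a \<in> f2.span B"
      by (metis bit_not_one_iff)
    show ?thesis
      unfolding 2 by (simp add: f2scale_cases 1)
  qed
  thus ?thesis
    unfolding f2.span_insert by (auto simp: image_iff f2_eq_add_iff)
qed

lemma f2_span_insert_subspace:
  assumes "f2.subspace H"
  shows "f2.span (insert a H) = H \<union> (+) a ` H"
  using f2_span_insert[of a H] assms by (simp add: f2.span_eq_iff[THEN iffD2])

lemma f2_subspace_double:
  assumes "f2.subspace H"
  shows "f2.subspace (H \<union> (+) a ` H)"
  using f2.subspace_span[of "insert a H"] assms by (simp add: f2_span_insert_subspace)

lemma f2_card_double:
  assumes "f2.subspace H" "finite H" "a \<notin> H"
  shows "card (H \<union> (+) a ` H) = 2 * card H"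
proof -
  have "H \<inter> (+) a ` H = {}"
    using assms by (auto simp: f2_subspace_iff) (metis add.commute f2_add_cancel)
  moreover have "card ((+) a ` H) = card H"
    by (simp add: card_image)
  ultimately show ?thesis
    using assms by (simp add: card_Un_disjoint)
qed

lemma f2_finite_span: "finite B \<Longrightarrow> finite (f2.span B)"
  by (induction B rule: finite_induct) (auto simp: f2_span_insert)

lemma f2_card_span:
  assumes "finite B" "f2.independent B"
  shows "card (f2.span B) = 2 ^ card B"
  using assms
proof (induction B rule: finite_induct)
  case (insert a B)
  hence "f2.independent B" "a \<notin> f2.span B"
    by (auto simp: f2.independent_insert)
  thus ?case
    using insert by (simp add: f2_span_insert f2_card_double f2_finite_span)
qed auto

text \<open>Dimension turns into cardinality here, so that later embeddings and codimension counts
  compare finite cardinalities. A basis of \<open>W\<close> is finite, and each of its vectors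
  doubles the span.\<close>

lemma f2_card_eq_dim:
  assumes "finite W" "f2.subspace W"
  shows "card W = 2 ^ f2.dim W"
proof -
  obtain B where B: "B \<subseteq> W" "f2.independent B" "W \<subseteq> f2.span B" "card B = f2.dim W"
    using f2.basis_exists by blast
  hence "f2.span B = W"
    using assms f2.span_minimal by blast
  thus ?thesis
    using f2_card_span[of B] B assms finite_subset by auto
qed

text \<open>A finitely generated space over a finite field is finite, and a finite subspace spans
  itself, so the existential over spanning sets reduces to finiteness.\<close>

lemma proj_space_iff: "proj_space V \<longleftrightarrow> f2.subspace (insert 0 V) \<and> finite V \<and> 0 \<notin> V"
proof
  assume "proj_space V"
  then obtain W B where "f2.subspace W" "finite B" "f2.span B = W" "V = W - {0}"
    unfolding proj_space_def by blast
  moreover from this have "insert 0 V = W"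
    using f2.subspace_0 by auto
  ultimately show "f2.subspace (insert 0 V) \<and> finite V \<and> 0 \<notin> V"
    using f2_finite_span by auto
next
  assume V: "f2.subspace (insert 0 V) \<and> finite V \<and> 0 \<notin> V"
  hence "f2.span (insert 0 V) = insert 0 V" "finite (insert 0 V)" "V = insert 0 V - {0}"
    by (simp_all add: f2.span_eq_iff[THEN iffD2] del: f2.span_insert_0)
  thus "proj_space V"
    unfolding proj_space_def using V by blast
qed

lemma proj_space_remove0: "f2.subspace W \<Longrightarrow> finite W \<Longrightarrow> proj_space (W - {0})"
  using f2.subspace_0[of W] by (simp add: proj_space_iff insert_absorb)

lemma card_proj_space: "proj_space V \<Longrightarrow> card (insert 0 V) = 2 ^ pdim V"
  unfolding pdim_def by (rule f2_card_eq_dim) (auto simp: proj_space_iff)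

lemma pdim_mono:
  assumes "proj_space U" "proj_space V" "U \<subseteq> V"
  shows "pdim U \<le> pdim V"
proof -
  have "card (insert 0 U) \<le> card (insert 0 V)"
    using assms by (intro card_mono) (auto simp: proj_space_iff)
  thus ?thesis
    using assms by (simp add: card_proj_space)
qed

section \<open>Standard coordinate spaces\<close>

definition vecs :: "nat \<Rightarrow> f2vec set" where
  "vecs n = {v. \<forall>i\<ge>n. v i = 0}"

lemma f2_subspace_vecs: "f2.subspace (vecs n)"
  by (auto simp: vecs_def f2_subspace_iff)

lemma vecs_Suc: "vecs (Suc n) = vecs n \<union> (+) (\<lambda>i. of_bool (i = n)) ` vecs n"
proof -
  let ?e = "\<lambda>i. of_bool (i = n) :: bit"
  have *: "v \<in> vecs n \<or> ?e + v \<in> vecs n" if "v \<in> vecs (Suc n)" for v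
  proof -
    have *: "v i = 0" if "i \<ge> n" "i \<noteq> n" for i
      using \<open>v \<in> vecs (Suc n)\<close> that by (simp add: vecs_def)
    show ?thesis
    proof (cases "v n")
      case zero
      hence "v i = 0" if "i \<ge> n" for i
        using * that by (cases "i = n") auto
      thus ?thesis
        by (simp add: vecs_def)
    next
      case one
      hence "(?e + v) i = 0" if "i \<ge> n" for i
        using * that by (cases "i = n") auto
      thus ?thesis
        by (simp add: vecs_def)
    qed
  qed
  moreover have "vecs n \<subseteq> vecs (Suc n)" "(+) ?e ` vecs n \<subseteq> vecs (Suc n)"
    by (auto simp: vecs_def)
  moreover have "vecs (Suc n) \<subseteq> vecs n \<union> (+) ?e ` vecs n"
    using * by (force simp: image_iff f2_eq_add_iff)
  ultimately show ?thesis
    by blast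
qed

lemma finite_vecs: "finite (vecs n)"
  and card_vecs: "card (vecs n) = 2 ^ n"
proof (induction n)
  case 0
  have "vecs 0 = {0}"
    by (auto simp: vecs_def fun_eq_iff)
  thus "finite (vecs 0)" "card (vecs 0) = 2 ^ 0"
    by simp_all
next
  case (Suc n)
  have "(\<lambda>i. of_bool (i = n)) \<notin> vecs n"
    by (auto simp: vecs_def)
  thus "finite (vecs (Suc n))" "card (vecs (Suc n)) = 2 ^ Suc n"
    using Suc by (simp_all add: vecs_Suc f2_card_double f2_subspace_vecs)
qed

lemma std_space_eq: "std_space n = vecs n - {0}"
  by (simp add: std_space_def vecs_def)

lemma insert_0_std_space [simp]: "insert 0 (std_space n) = vecs n"
  using f2.subspace_0[OF f2_subspace_vecs] by (auto simp: std_space_eq)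

lemma proj_space_std_space: "proj_space (std_space n)"
  by (simp add: std_space_eq proj_space_remove0 f2_subspace_vecs finite_vecs)

lemma pdim_std_space: "pdim (std_space n) = n"
  using card_proj_space[OF proj_space_std_space, of n] by (simp add: card_vecs)

lemma finite_std_space: "finite (std_space n)"
  by (simp add: std_space_eq finite_vecs)

text \<open>Supplies a direction outside any given finite subspace: \<open>vecs (card H)\<close> has
  more than \<open>card H\<close> elements.\<close>

lemma ex_not_in_finite:
  assumes "finite (H :: f2vec set)"
  shows "\<exists>a. a \<notin> H"
proof (rule ccontr)
  assume "\<nexists>a. a \<notin> H"
  hence "vecs (card H) \<subseteq> H"
    by auto
  hence "2 ^ card H \<le> card H"
    using card_mono[OF assms] by (metis card_vecs)
  thus False
    using less_exp[of "card H"] by linarith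
qed

section \<open>Injective linear maps\<close>

text \<open>Scalars do not appear because 0 and 1 are the only ones: compatibility with 0 amounts to
  \<phi> 0 = 0, which additivity gives by x + x = 0.\<close>

definition additive_inj_on :: "(f2vec \<Rightarrow> f2vec) \<Rightarrow> f2vec set \<Rightarrow> bool" where
  "additive_inj_on \<phi> W \<longleftrightarrow> (\<forall>x\<in>W. \<forall>y\<in>W. \<phi> (x + y) = \<phi> x + \<phi> y) \<and> inj_on \<phi> W"

lemma additive_inj_on_0: "additive_inj_on \<phi> W \<Longrightarrow> 0 \<in> W \<Longrightarrow> \<phi> 0 = 0"
  unfolding additive_inj_on_def by (metis add_0 f2_add_self)

lemma additive_inj_on_subset: "additive_inj_on \<phi> W \<Longrightarrow> U \<subseteq> W \<Longrightarrow> additive_inj_on \<phi> U"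
  unfolding additive_inj_on_def by (meson inj_on_subset subsetD)

lemma additive_inj_on_subspace_image:
  "additive_inj_on \<phi> W \<Longrightarrow> f2.subspace W \<Longrightarrow> f2.subspace (\<phi> ` W)"
  using additive_inj_on_0[of \<phi> W] unfolding additive_inj_on_def f2_subspace_iff
  by (auto simp: image_iff) metis+

lemma additive_inj_on_inv_into:
  assumes "additive_inj_on \<phi> W" "f2.subspace W"
  shows "additive_inj_on (inv_into W \<phi>) (\<phi> ` W)"
proof -
  have "inv_into W \<phi> (\<phi> x + \<phi> y) = x + y" if "x \<in> W" "y \<in> W" for x y
    using assms that unfolding additive_inj_on_def f2_subspace_iff by (metis inv_into_f_f)
  thus ?thesis
    using assms unfolding additive_inj_on_def by (auto simp: inj_on_inv_into)
qed

text \<open>Sending \<open>a\<close> to \<open>x\<close> extends \<phi> to the doubled space. The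
  hypothesis on \<open>x\<close> keeps the two image cosets apart: x + \<phi> u = \<phi> v would
  give x = \<phi> (u + v).\<close>

lemma additive_inj_on_double:
  assumes \<phi>: "additive_inj_on \<phi> H" and H: "f2.subspace H"
    and a: "a \<notin> H" and x: "x \<notin> \<phi> ` H"
  obtains \<psi> where "additive_inj_on \<psi> (H \<union> (+) a ` H)" "\<And>u. u \<in> H \<Longrightarrow> \<psi> u = \<phi> u"
    "\<And>u. u \<in> H \<Longrightarrow> \<psi> (a + u) = x + \<phi> u"
proof -
  \<comment> \<open>For v = a + u with \<open>u\<close> in \<open>H\<close>, the vector
    \<open>a + v\<close> is the component \<open>u\<close>.\<close>
  define \<psi> where "\<psi> v = (if v \<in> H then \<phi> v else x + \<phi> (a + v))" for v
  have H': "u + v \<in> H" "0 \<in> H" if "u \<in> H" "v \<in> H" for u v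
    using H that by (auto simp: f2_subspace_iff)
  have 1: "\<psi> u = \<phi> u" if "u \<in> H" for u
    using that by (simp add: \<psi>_def)
  have notin: "a + u \<notin> H" if "u \<in> H" for u
    using a H'(1)[OF _ that, of "a + u"] by (auto simp: add.assoc)
  have 2: "\<psi> (a + u) = x + \<phi> u" if "u \<in> H" for u
    using that notin by (simp add: \<psi>_def)
  have add: "\<phi> (u + v) = \<phi> u + \<phi> v" if "u \<in> H" "v \<in> H" for u v
    using \<phi> that by (simp add: additive_inj_on_def)
  have inj: "\<phi> u = \<phi> v \<Longrightarrow> u = v" if "u \<in> H" "v \<in> H" for u v
    using \<phi> that by (auto simp: additive_inj_on_def inj_on_def)
  have xn: "x + \<phi> u \<noteq> \<phi> v" if "u \<in> H" "v \<in> H" for u v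
  proof
    assume "x + \<phi> u = \<phi> v"
    hence "x = \<phi> (u + v)"
      using add that by (metis add.commute f2_add_cancel)
    thus False
      using x H'(1) that by blast
  qed
  have "\<psi> (u + v) = \<psi> u + \<psi> v"
    if "u \<in> H \<union> (+) a ` H" "v \<in> H \<union> (+) a ` H" for u v
  proof -
    have r: "u' + (a + v') = a + (u' + v')" "a + u' + (a + v') = u' + v'"
      "x + u' + (x + v') = u' + v'" "u' + (x + v') = x + (u' + v')" for u' v'
      by (simp_all add: ac_simps)
    from that show ?thesis
      by (auto simp: 1 2 H' add add.assoc r)
  qed
  moreover have "inj_on \<psi> (H \<union> (+) a ` H)"
    using xn inj by (auto simp: inj_on_def 1 2) (metis xn)+
  ultimately have "additive_inj_on \<psi> (H \<union> (+) a ` H)"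
    unfolding additive_inj_on_def by blast
  thus ?thesis
    using 1 2 that by blast
qed

text \<open>A vector outside the span of \<open>B\<close> doubles it, so the image built so far
  fills at most half of \<open>D\<close>, and a value for the new vector is left outside that
  image.\<close>

lemma ex_additive_inj_on_span:
  assumes "finite B" "f2.subspace D" "finite D" "card (f2.span B) \<le> card D"
  shows "\<exists>\<phi>. additive_inj_on \<phi> (f2.span B) \<and> \<phi> ` f2.span B \<subseteq> D"
  using assms(1,4)
proof (induction B rule: finite_induct)
  case empty
  have "additive_inj_on (\<lambda>_. 0) {0}"
    by (simp add: additive_inj_on_def)
  thus ?case
    using assms by (auto simp: f2_subspace_iff)
next
  case (insert a B)
  let ?H = "f2.span B"
  show ?case
  proof (cases "a \<in> ?H")
    case True
    thus ?thesis
      using insert by (simp add: f2.span_redundant)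
  next
    case False
    hence c: "2 * card ?H \<le> card D"
      using insert by (simp add: f2_span_insert f2_card_double f2_finite_span)
    then obtain \<phi> where \<phi>: "additive_inj_on \<phi> ?H" "\<phi> ` ?H \<subseteq> D"
      using insert by auto
    have "card ?H > 0"
      using insert f2_finite_span f2.span_zero by (metis card_gt_0_iff empty_iff)
    hence "card (\<phi> ` ?H) < card D"
      using c card_image_le[OF f2_finite_span[OF insert(1)], of \<phi>] by linarith
    then obtain x where x: "x \<in> D" "x \<notin> \<phi> ` ?H"
      using \<phi> by (metis less_irrefl subsetI subset_antisym)
    obtain \<psi> where \<psi>: "additive_inj_on \<psi> (?H \<union> (+) a ` ?H)" "\<And>u. u \<in> ?H \<Longrightarrow> \<psi> u = \<phi> u"
      "\<And>u. u \<in> ?H \<Longrightarrow> \<psi> (a + u) = x + \<phi> u"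
      using additive_inj_on_double[OF \<phi>(1) f2.subspace_span False x(2)] by blast
    have "\<psi> ` (?H \<union> (+) a ` ?H) \<subseteq> D"
      using \<psi>(2,3) \<phi>(2) x assms(2) by (auto simp: f2_subspace_iff)
    thus ?thesis
      using \<psi>(1) by (auto simp: f2_span_insert)
  qed
qed

lemma ex_additive_inj_on:
  assumes "f2.subspace H" "finite H" "f2.subspace D" "finite D" "card H \<le> card D"
  shows "\<exists>\<phi>. additive_inj_on \<phi> H \<and> \<phi> ` H \<subseteq> D"
  using ex_additive_inj_on_span[of H D] assms by (simp add: f2.span_eq_iff[THEN iffD2])

section \<open>Linear injections and closure of properties under pullback\<close>

lemma linear_injectionI:
  assumes "additive_inj_on \<phi> (insert 0 V)" "\<And>x. x \<in> V \<Longrightarrow> \<phi> x \<in> V'"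
  shows "linear_injection \<phi> V V'"
proof -
  have "\<phi> 0 = 0"
    using additive_inj_on_0[OF assms(1)] by simp
  thus ?thesis
    using assms unfolding linear_injection_def additive_inj_on_def f2scale_cases by simp blast
qed

text \<open>The definition only places values in \<open>insert 0 V'\<close>. A nonzero vector cannot
  be sent to 0, since 0 is already the value at 0.\<close>

lemma linear_injectionD:
  assumes "linear_injection \<phi> V V'" "0 \<notin> V"
  shows "additive_inj_on \<phi> (insert 0 V)" "\<phi> ` V \<subseteq> V'"
proof -
  show *: "additive_inj_on \<phi> (insert 0 V)"
    using assms unfolding linear_injection_def additive_inj_on_def by blast
  show "\<phi> ` V \<subseteq> V'"
  proof
    fix y assume "y \<in> \<phi> ` V"
    then obtain x where x: "x \<in> V" "y = \<phi> x"
      by blast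
    hence "\<phi> x \<noteq> \<phi> 0"
      using * assms(2) unfolding additive_inj_on_def inj_on_def by (metis insertCI)
    thus "y \<in> V'"
      using x assms(1) additive_inj_on_0[OF *] by (auto simp: linear_injection_def)
  qed
qed

text \<open>\<open>M'\<close> is isomorphic to the restriction of \<open>M\<close> to the image of
  \<phi>, which lies in \<open>T\<close> by heredity. As \<open>matroid_property\<close> transfers
  membership along isomorphisms starting at a member, the witness is the inverse of \<phi>.\<close>

lemma matroid_property_pullback:
  assumes T: "matroid_property T" "hereditary T" and M: "M \<in> T" "is_matroid M'"
    and \<phi>: "linear_injection \<phi> (dom M') (dom M)"
    and eq: "\<And>x. x \<in> dom M' \<Longrightarrow> M' x = M (\<phi> x)"
  shows "M' \<in> T"
proof -
  let ?U = "\<phi> ` dom M'" and ?W = "insert 0 (dom M')"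
  have M': "f2.subspace ?W" "finite (dom M')" "0 \<notin> dom M'"
    using M by (auto simp: is_matroid_def proj_space_iff)
  note \<phi>' = linear_injectionD[OF \<phi> M'(3)]
  have \<phi>0: "\<phi> 0 = 0"
    using additive_inj_on_0[OF \<phi>'(1)] by simp
  have im: "\<phi> ` ?W = insert 0 ?U"
    using \<phi>0 by simp
  have "0 \<notin> ?U"
    using \<phi>'(1) \<phi>0 M'(3) unfolding additive_inj_on_def inj_on_def by (metis imageE insertCI)
  hence "proj_space ?U"
    using additive_inj_on_subspace_image[OF \<phi>'(1) M'(1)] M'(2)
    by (simp add: proj_space_iff im \<phi>0)
  hence "M |` ?U \<in> T"
    using T(2) M(1) \<phi>'(2) unfolding hereditary_def proj_subspace_def by blast
  moreover have "dom (M |` ?U) = ?U"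
    using \<phi>'(2) by (simp add: Int_absorb1)
  moreover have "isomorphic (M |` ?U) M'"
    unfolding isomorphic_def \<open>dom (M |` ?U) = ?U\<close>
  proof (intro exI conjI)
    let ?i = "inv_into ?W \<phi>"
    have i: "?i (\<phi> x) = x" if "x \<in> dom M'" for x
      using \<phi>'(1) that unfolding additive_inj_on_def by (intro inv_into_f_f) auto
    show "linear_injection ?i ?U (dom M')"
    proof (rule linear_injectionI)
      show "additive_inj_on ?i (insert 0 ?U)"
        using additive_inj_on_inv_into[OF \<phi>'(1) M'(1)] by (simp add: \<phi>0)
    next
      fix y assume "y \<in> ?U"
      then obtain x where "x \<in> dom M'" "y = \<phi> x"
        by blast
      thus "?i y \<in> dom M'"
        using i[of x] by (simp del: domIff)
    qed
    show "?i ` ?U = dom M'"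
      unfolding image_image by (rule trans[OF image_cong[OF refl i]]) simp_all
    show "\<forall>x\<in>?U. (M |` ?U) x = M' (?i x)"
      using i eq by (force simp: restrict_map_def simp del: domIff)
  qed
  ultimately show ?thesis
    using T(1) M(2) unfolding matroid_property_def by blast
qed

section \<open>Flats in dense sets and monochromatic subspaces\<close>

text \<open>Induction on \<open>k\<close>, which works because a positive proportion of base points
  is kept. If \<open>R\<close> is the set of base points for \<open>D\<close>, a popular difference
  \<open>u\<close> outside \<open>D\<close> has many \<open>x\<close> with both \<open>x\<close> and
  \<open>u + x\<close> in \<open>R\<close>; these are base points for the doubled space spanned by
  \<open>D\<close> and \<open>u\<close>.\<close>

lemma dense_contains_many_flats:
  fixes \<delta> :: real
  assumes "\<delta> > 0"
  shows "\<exists>\<delta>' :: real. \<delta>' > 0 \<and> (\<exists>N. \<forall>W S. f2.subspace W \<and> finite W \<and> N \<le> card W \<and> S \<subseteq> W \<and>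
    \<delta> * card W \<le> card S \<longrightarrow>
    (\<exists>D\<subseteq>W. f2.subspace D \<and> card D = 2 ^ k \<and>
      \<delta>' * card W \<le> card {x\<in>W. \<forall>d\<in>D. x + d \<in> S}))"
  (is "\<exists>\<delta>'. \<delta>' > 0 \<and> (\<exists>N. ?P \<delta>' N k)")
proof (induction k)
  case 0
  have "\<exists>D\<subseteq>W. f2.subspace D \<and> card D = 2 ^ 0 \<and> \<delta> * card W \<le> card {x\<in>W. \<forall>d\<in>D. x + d \<in> S}"
    if "f2.subspace W" "S \<subseteq> W" "\<delta> * card W \<le> card S" for W S
  proof (intro exI conjI)
    have "{x \<in> W. \<forall>d\<in>{0}. x + d \<in> S} = S"
      using that by auto
    thus "\<delta> * card W \<le> card {x\<in>W. \<forall>d\<in>{0}. x + d \<in> S}"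
      using that by simp
  qed (use that in \<open>auto simp: f2_subspace_iff\<close>)
  hence "?P \<delta> 0 0"
    by blast
  thus ?case
    using assms by (intro exI conjI)
next
  case (Suc k)
  then obtain \<epsilon> N where \<epsilon>: "\<epsilon> > 0" and N: "?P \<epsilon> N k"
    by (elim exE conjE)
  \<comment> \<open>Chosen so that \<open>D\<close>, of size 2 ^ k, has at most half the size
    guaranteed for \<open>R\<close>; excluding differences in \<open>D\<close> then costs at most
    half of the pairs.\<close>
  define N' where "N' = max N (nat \<lceil>2 * 2 ^ k / \<epsilon>\<rceil>)"
  have "\<exists>D\<subseteq>W. f2.subspace D \<and> card D = 2 ^ Suc k \<and>
      \<epsilon>\<^sup>2 / 4 * card W \<le> card {x\<in>W. \<forall>d\<in>D. x + d \<in> S}"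
    if W: "f2.subspace W" "finite W" "N' \<le> card W" and S: "S \<subseteq> W" "\<delta> * card W \<le> card S" for W S
  proof -
    obtain D where D: "D \<subseteq> W" "f2.subspace D" "card D = 2 ^ k"
        "\<epsilon> * card W \<le> card {x\<in>W. \<forall>d\<in>D. x + d \<in> S}"
      using N[rule_format, of W S] W S unfolding N'_def by auto
    define R where "R = {x\<in>W. \<forall>d\<in>D. x + d \<in> S}"
    have R: "R \<subseteq> W" "finite R"
      using W by (auto simp: R_def)
    have finD: "finite D"
      using D W finite_subset by blast
    have w: "card W > 0"
      using W by (auto simp: f2_subspace_iff card_gt_0_iff)
    have kw: "2 ^ k \<le> \<epsilon> * card W / 2"
    proof -
      have "2 * 2 ^ k / \<epsilon> \<le> card W"
        using W(3) unfolding N'_def by linarith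
      thus ?thesis
        using \<epsilon> by (simp add: field_simps)
    qed
    define f where "f u = card {x\<in>R. u + x \<in> R}" for u
    \<comment> \<open>The differences \<open>u\<close> with \<open>u + x\<close> in \<open>R\<close>
      form the translate x + R, and at most \<open>card D\<close> of them lie in
      \<open>D\<close>.\<close>
    have deg: "card R \<le> card {u \<in> W - D. u + x \<in> R} + 2 ^ k" if x: "x \<in> R" for x
    proof -
      have "(+) x ` R \<subseteq> {u \<in> W - D. u + x \<in> R} \<union> D"
        using W(1) x R(1) by (auto simp: f2_subspace_iff add.commute[of _ x])
      hence "card ((+) x ` R) \<le> card ({u \<in> W - D. u + x \<in> R} \<union> D)"
        using W(2) finD by (intro card_mono) auto
      also have "\<dots> \<le> card {u \<in> W - D. u + x \<in> R} + card D"
        by (rule card_Un_le)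
      finally show ?thesis
        using D by (simp add: card_image)
    qed
    have "\<exists>u\<in>W - D. \<epsilon>\<^sup>2 / 4 * card W \<le> f u"
    proof (rule ccontr)
      assume "\<not> ?thesis"
      hence small: "f u \<le> \<epsilon>\<^sup>2 / 4 * card W" if "u \<in> W - D" for u
        using that by force
      \<comment> \<open>Double counting of the pairs (u, x) with \<open>x\<close> and
        \<open>u + x\<close> in \<open>R\<close>. Their number is at least half the square of
        \<epsilon> |W|, whereas without a popular \<open>u\<close> it is at most a quarter of that
        square.\<close>
      have "(\<Sum>u\<in>W - D. f u) = (\<Sum>x\<in>R. card {u \<in> W - D. u + x \<in> R})"
        unfolding f_def by (rule sum_multicount_gen) (use W R in auto)
      hence "(\<Sum>u\<in>W - D. real (f u)) = (\<Sum>x\<in>R. real (card {u \<in> W - D. u + x \<in> R}))"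
        unfolding of_nat_sum[symmetric] by (rule arg_cong)
      also have "\<dots> \<ge> (\<Sum>x\<in>R. real (card R) - 2 ^ k)"
      proof (rule sum_mono)
        fix x assume "x \<in> R"
        from of_nat_mono[OF deg[OF this], where 'a = real]
        show "real (card R) - 2 ^ k \<le> real (card {u \<in> W - D. u + x \<in> R})"
          by simp
      qed
      finally have "card R * (real (card R) - 2 ^ k) \<le> (\<Sum>u\<in>W - D. real (f u))"
        by simp
      also have "\<dots> \<le> card (W - D) * (\<epsilon>\<^sup>2 / 4 * card W)"
        using small by (rule sum_bounded_above)
      also have "\<dots> \<le> card W * (\<epsilon>\<^sup>2 / 4 * card W)"
        using W(2) by (intro mult_right_mono) (auto intro: card_mono)
      finally have "card R * (real (card R) - 2 ^ k) \<le> (\<epsilon> * card W)\<^sup>2 / 4"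
        by (simp add: power2_eq_square algebra_simps)
      moreover have "(\<epsilon> * card W) * (\<epsilon> * card W / 2) \<le> card R * (real (card R) - 2 ^ k)"
        using D(4) kw \<epsilon> unfolding R_def[symmetric] by (intro mult_mono) auto
      moreover have "0 < (\<epsilon> * card W)\<^sup>2"
        using \<epsilon> w by simp
      ultimately show False
        by (simp add: power2_eq_square)
    qed
    then obtain u where u: "u \<in> W" "u \<notin> D" "\<epsilon>\<^sup>2 / 4 * card W \<le> f u"
      by blast
    let ?D = "D \<union> (+) u ` D"
    have "{x\<in>R. u + x \<in> R} \<subseteq> {x\<in>W. \<forall>d\<in>?D. x + d \<in> S}"
      by (auto simp: R_def ac_simps)
    hence "f u \<le> card {x\<in>W. \<forall>d\<in>?D. x + d \<in> S}"
      unfolding f_def using W(2) by (intro card_mono) auto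
    moreover have "?D \<subseteq> W"
      using D(1) u(1) W(1) by (auto simp: f2_subspace_iff)
    moreover have "f2.subspace ?D" "card ?D = 2 ^ Suc k"
      using D u finD by (simp_all add: f2_subspace_double f2_card_double)
    ultimately show ?thesis
      using u(3) by (intro exI[of _ ?D]) linarith
  qed
  thus ?case
    using \<epsilon> by (intro exI[of _ "\<epsilon>\<^sup>2 / 4"] conjI exI[of _ N'] allI impI) (simp, blast)
qed

lemma dense_contains_flat:
  fixes \<delta> :: real
  assumes "\<delta> > 0"
  obtains N where "\<And>W S. f2.subspace W \<Longrightarrow> finite W \<Longrightarrow> N \<le> card W \<Longrightarrow> S \<subseteq> W \<Longrightarrow>
    \<delta> * card W \<le> card S \<Longrightarrow>
    \<exists>D x. D \<subseteq> W \<and> f2.subspace D \<and> card D = 2 ^ k \<and> x \<in> W \<and> (\<forall>d\<in>D. x + d \<in> S)"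
proof -
  obtain \<epsilon> :: real and N where \<epsilon>: "\<epsilon> > 0" and N: "\<forall>W S. f2.subspace W \<and> finite W \<and> N \<le> card W \<and>
      S \<subseteq> W \<and> \<delta> * card W \<le> card S \<longrightarrow>
      (\<exists>D\<subseteq>W. f2.subspace D \<and> card D = 2 ^ k \<and> \<epsilon> * card W \<le> card {x\<in>W. \<forall>d\<in>D. x + d \<in> S})"
    using dense_contains_many_flats[OF assms, of k] by (elim exE conjE)
  have "\<exists>D x. D \<subseteq> W \<and> f2.subspace D \<and> card D = 2 ^ k \<and> x \<in> W \<and> (\<forall>d\<in>D. x + d \<in> S)"
    if W: "f2.subspace W" "finite W" "N \<le> card W" "S \<subseteq> W" "\<delta> * card W \<le> card S" for W S
  proof -
    obtain D where D: "D \<subseteq> W" "f2.subspace D" "card D = 2 ^ k"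
        "\<epsilon> * card W \<le> card {x\<in>W. \<forall>d\<in>D. x + d \<in> S}"
      using N[rule_format, of W S] W by blast
    have "card W > 0"
      using W by (auto simp: f2_subspace_iff card_gt_0_iff)
    hence "0 < \<epsilon> * card W"
      using \<epsilon> by simp
    hence "card {x\<in>W. \<forall>d\<in>D. x + d \<in> S} \<noteq> 0"
      using D(4) by linarith
    hence "{x\<in>W. \<forall>d\<in>D. x + d \<in> S} \<noteq> {}"
      by (metis card.empty)
    thus ?thesis
      using D by blast
  qed
  thus ?thesis
    using that by blast
qed

text \<open>The two colour classes share |W| - 1 nonzero vectors, so one of them has at least |W| /
  4 elements. Leaving 0 out of the classes forces \<open>x\<close> outside \<open>D\<close>, since
  otherwise x + x = 0 would lie in the flat.\<close>

lemma monochromatic_flat: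
  obtains N where "\<And>W P. f2.subspace W \<Longrightarrow> finite W \<Longrightarrow> N \<le> card W \<Longrightarrow>
    \<exists>D x. D \<subseteq> W \<and> f2.subspace D \<and> card D = 2 ^ k \<and> x \<in> W \<and> x \<notin> D \<and>
      ((\<forall>d\<in>D. P (x + d)) \<or> (\<forall>d\<in>D. \<not> P (x + d)))"
proof -
  obtain N where N: "\<And>W S. f2.subspace W \<Longrightarrow> finite W \<Longrightarrow> N \<le> card W \<Longrightarrow> S \<subseteq> W \<Longrightarrow>
      1 / 4 * real (card W) \<le> card S \<Longrightarrow>
      \<exists>D x. D \<subseteq> W \<and> f2.subspace D \<and> card D = 2 ^ k \<and> x \<in> W \<and> (\<forall>d\<in>D. x + d \<in> S)"
    by (rule dense_contains_flat[of "1 / 4" k]) (simp, blast)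
  have "\<exists>D x. D \<subseteq> W \<and> f2.subspace D \<and> card D = 2 ^ k \<and> x \<in> W \<and> x \<notin> D \<and>
      ((\<forall>d\<in>D. P (x + d)) \<or> (\<forall>d\<in>D. \<not> P (x + d)))"
    if W: "f2.subspace W" "finite W" "max N 2 \<le> card W" for W P
  proof -
    let ?S = "\<lambda>b. {x \<in> W - {0}. P x = b}"
    have "card W - 1 = card (W - {0})"
      using W(1) by (simp add: f2_subspace_iff)
    also have "W - {0} = ?S True \<union> ?S False"
      by auto
    also have "card \<dots> = card (?S True) + card (?S False)"
      by (rule card_Un_disjoint) (use W(2) in auto)
    finally have "card W \<le> 4 * card (?S True) \<or> card W \<le> 4 * card (?S False)"
      using W(3) by linarith
    then obtain b where "card W \<le> 4 * card (?S b)"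
      by blast
    hence "1 / 4 * real (card W) \<le> card (?S b)"
      by linarith
    moreover have "?S b \<subseteq> W"
      by blast
    ultimately obtain D x where D: "D \<subseteq> W" "f2.subspace D" "card D = 2 ^ k" "x \<in> W"
        "\<forall>d\<in>D. x + d \<in> ?S b"
      using N[OF W(1,2)] W(3) by (metis (no_types, lifting) max.bounded_iff)
    hence "x \<notin> D"
      by force
    moreover have "(\<forall>d\<in>D. P (x + d)) \<or> (\<forall>d\<in>D. \<not> P (x + d))"
      using D(5) by (cases b) auto
    ultimately show ?thesis
      using D by blast
  qed
  thus ?thesis
    using that by blast
qed

text \<open>Given a monochromatic coset x + U, apply the induction hypothesis inside
  \<open>U\<close>, asking for one dimension less in the colour of the coset. A subspace
  \<open>D\<close> found in that colour extends by x + D; one found in the other colour is already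
  large enough. Two separate parameters are kept because the colour of the coset is not under
  control.\<close>

lemma subspace_Ramsey_off_diagonal:
  "\<exists>N. \<forall>W P. f2.subspace W \<and> finite W \<and> N \<le> card W \<longrightarrow>
    (\<exists>D\<subseteq>W. f2.subspace D \<and>
      (card D = 2 ^ a \<and> (\<forall>x\<in>D - {0}. P x) \<or> card D = 2 ^ b \<and> (\<forall>x\<in>D - {0}. \<not> P x)))"
  (is "\<exists>N. ?R N a b")
proof (induction "a + b" arbitrary: a b)
  case 0
  have "?R 0 0 0"
    by (auto intro!: exI[of _ "{0}"] simp: f2_subspace_iff)
  thus ?case
    using 0 by auto
next
  case (Suc n)
  show ?case
  proof (cases "a = 0 \<or> b = 0")
    case True
    \<comment> \<open>The subspace consisting of 0 alone has 2 ^ 0 elements and satisfies the colour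
      condition vacuously.\<close>
    hence "?R 0 a b"
      by (auto intro!: exI[of _ "{0}"] simp: f2_subspace_iff)
    thus ?thesis
      by blast
  next
    case False
    then obtain a' b' where ab: "a = Suc a'" "b = Suc b'"
      by (metis not0_implies_Suc)
    obtain N1 where N1: "?R N1 a' b"
      using Suc(1)[of a' b] Suc(2) ab(1) by (metis add_Suc nat.inject)
    obtain N2 where N2: "?R N2 a b'"
      using Suc(1)[of a b'] Suc(2) ab(2) by (metis add_Suc_right nat.inject)
    \<comment> \<open>Since 2 ^ (N1 + N2) exceeds both \<open>N1\<close> and \<open>N2\<close>, the
      subspace \<open>U\<close> suits either recursive call.\<close>
    obtain N where N: "\<And>W P. f2.subspace W \<Longrightarrow> finite W \<Longrightarrow> N \<le> card W \<Longrightarrow>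
        \<exists>U x. U \<subseteq> W \<and> f2.subspace U \<and> card U = 2 ^ (N1 + N2) \<and> x \<in> W \<and> x \<notin> U \<and>
          ((\<forall>d\<in>U. P (x + d)) \<or> (\<forall>d\<in>U. \<not> P (x + d)))"
      using monochromatic_flat by blast
    have "\<exists>D\<subseteq>W. f2.subspace D \<and>
        (card D = 2 ^ a \<and> (\<forall>x\<in>D - {0}. P x) \<or> card D = 2 ^ b \<and> (\<forall>x\<in>D - {0}. \<not> P x))"
      if W: "f2.subspace W" "finite W" "N \<le> card W" for W P
    proof -
      obtain U x where U: "U \<subseteq> W" "f2.subspace U" "card U = 2 ^ (N1 + N2)" "x \<in> W" "x \<notin> U"
          and mono: "(\<forall>d\<in>U. P (x + d)) \<or> (\<forall>d\<in>U. \<not> P (x + d))"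
        using N[OF W] by blast
      have "N1 + N2 < card U"
        unfolding U(3) by (rule less_exp)
      moreover have finU: "finite U"
        using U W finite_subset by blast
      moreover have double: "D \<union> (+) x ` D \<subseteq> W" "f2.subspace (D \<union> (+) x ` D)"
          "card (D \<union> (+) x ` D) = 2 * card D" if "D \<subseteq> U" "f2.subspace D" for D
      proof -
        show "D \<union> (+) x ` D \<subseteq> W"
          using that U W(1) by (auto simp: f2_subspace_iff)
        show "f2.subspace (D \<union> (+) x ` D)" "card (D \<union> (+) x ` D) = 2 * card D"
          using that U finite_subset[OF _ finU, of D]
          by (auto intro: f2_subspace_double f2_card_double)
      qed
      from mono show ?thesis
      proof
        assume x: "\<forall>d\<in>U. P (x + d)"
        obtain D where D: "D \<subseteq> U" "f2.subspace D"
            "card D = 2 ^ a' \<and> (\<forall>x\<in>D - {0}. P x) \<or> card D = 2 ^ b \<and> (\<forall>x\<in>D - {0}. \<not> P x)"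
          using N1[rule_format, of U P] U(2) finU \<open>N1 + N2 < card U\<close> by auto
        thus ?thesis
        proof (elim disjE)
          assume "card D = 2 ^ a' \<and> (\<forall>x\<in>D - {0}. P x)"
          hence "card (D \<union> (+) x ` D) = 2 ^ a" "\<forall>y\<in>D \<union> (+) x ` D - {0}. P y"
            using double[OF D(1,2)] x D(1) ab by auto
          thus ?thesis
            using double[OF D(1,2)] by blast
        qed (use D U in blast)
      next
        assume x: "\<forall>d\<in>U. \<not> P (x + d)"
        obtain D where D: "D \<subseteq> U" "f2.subspace D"
            "card D = 2 ^ a \<and> (\<forall>x\<in>D - {0}. P x) \<or> card D = 2 ^ b' \<and> (\<forall>x\<in>D - {0}. \<not> P x)"
          using N2[rule_format, of U P] U(2) finU \<open>N1 + N2 < card U\<close> by auto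
        thus ?thesis
        proof (elim disjE)
          assume "card D = 2 ^ b' \<and> (\<forall>x\<in>D - {0}. \<not> P x)"
          hence "card (D \<union> (+) x ` D) = 2 ^ b" "\<forall>y\<in>D \<union> (+) x ` D - {0}. \<not> P y"
            using double[OF D(1,2)] x D(1) ab by auto
          thus ?thesis
            using double[OF D(1,2)] by blast
        qed (use D U in blast)
      qed
    qed
    thus ?thesis
      by blast
  qed
qed

lemma subspace_Ramsey:
  obtains m where "\<And>P. \<exists>D\<subseteq>vecs m. f2.subspace D \<and> card D = 2 ^ d \<and>
    ((\<forall>x\<in>D - {0}. P x) \<or> (\<forall>x\<in>D - {0}. \<not> P x))"
proof -
  obtain N where N: "\<And>W P. f2.subspace W \<and> finite W \<and> N \<le> card W \<Longrightarrow>
    (\<exists>D\<subseteq>W. f2.subspace D \<and>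
      (card D = 2 ^ d \<and> (\<forall>x\<in>D - {0}. P x) \<or> card D = 2 ^ d \<and> (\<forall>x\<in>D - {0}. \<not> P x)))"
    using subspace_Ramsey_off_diagonal[of d d] by metis
  have "N \<le> card (vecs N)"
    unfolding card_vecs using less_exp[of N] by linarith
  thus ?thesis
    using N[of "vecs N"] that[of N] f2_subspace_vecs finite_vecs by metis
qed

section \<open>Shattered sets\<close>

definition shatters :: "'a set set \<Rightarrow> 'a set \<Rightarrow> bool" where
  "shatters F S \<longleftrightarrow> (\<forall>Y\<subseteq>S. \<exists>Z\<in>F. Z \<inter> S = Y)"

lemma shatters_mono: "shatters F S \<Longrightarrow> F \<subseteq> G \<Longrightarrow> shatters G S"
  unfolding shatters_def by (meson subsetD)

text \<open>Pajor's form of the Sauer-Shelah lemma, by splitting at \<open>a\<close>. A set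
  shattered by \<open>F0\<close> or by \<open>F1\<close> is shattered by \<open>F\<close>; a set
  \<open>S\<close> shattered by both also makes \<open>insert a S\<close> shattered. The latter sets
  contain \<open>a\<close>, so they are new, and they account for the intersection in |A| + |B| = |A
  \<union> B| + |A \<inter> B|.\<close>

lemma card_le_card_shattered:
  assumes "finite X" "F \<subseteq> Pow X"
  shows "card F \<le> card {S. S \<subseteq> X \<and> shatters F S}"
  using assms
proof (induction X arbitrary: F rule: finite_induct)
  case empty
  hence "F \<subseteq> {{}}"
    by simp
  hence "F = {} \<or> F = {{}}"
    by blast
  thus ?case
  proof
    assume "F = {{}}"
    hence "{} \<in> {S. S \<subseteq> {} \<and> shatters F S}"
      unfolding shatters_def by blast
    moreover have "card F = 1"
      using \<open>F = {{}}\<close> by simp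
    moreover have "finite {S. S \<subseteq> {} \<and> shatters F S}"
      by (rule finite_subset[of _ "{{}}"]) blast+
    ultimately show ?case
      by (metis One_nat_def Suc_leI card_gt_0_iff empty_iff)
  next
    assume "F = {}"
    thus ?case
      by simp
  qed
next
  case (insert a X)
  define F0 where "F0 = {Z\<in>F. a \<notin> Z}"
  define F1 where "F1 = (\<lambda>Z. Z - {a}) ` {Z\<in>F. a \<in> Z}"
  let ?sh = "\<lambda>F. {S. S \<subseteq> X \<and> shatters F S}"
  have finF: "finite F"
    using insert.hyps(1) insert.prems finite_subset[of F "Pow (insert a X)"] by simp
  have "card F = card F0 + card {Z\<in>F. a \<in> Z}"
  proof -
    have "card F0 + card {Z\<in>F. a \<in> Z} = card (F0 \<union> {Z\<in>F. a \<in> Z})"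
      unfolding F0_def using finF by (intro card_Un_disjoint[symmetric]) auto
    also have "F0 \<union> {Z\<in>F. a \<in> Z} = F"
      by (auto simp: F0_def)
    finally show ?thesis ..
  qed
  also have "card {Z\<in>F. a \<in> Z} = card F1"
  proof -
    have "inj_on (\<lambda>Z. Z - {a}) {Z\<in>F. a \<in> Z}"
      by (rule inj_onI) (metis (mono_tags, lifting) insert_Diff mem_Collect_eq)
    thus ?thesis
      by (simp add: F1_def card_image)
  qed
  also have "card F0 + card F1 \<le> card (?sh F0) + card (?sh F1)"
  proof (rule add_mono)
    show "card F0 \<le> card (?sh F0)"
      using insert.prems by (intro insert.IH) (auto simp: F0_def)
    show "card F1 \<le> card (?sh F1)"
      using insert.prems by (intro insert.IH) (auto simp: F1_def)
  qed
  also have "\<dots> = card (?sh F0 \<union> ?sh F1) + card (?sh F0 \<inter> ?sh F1)"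
    using insert.hyps(1) by (intro card_Un_Int) auto
  also have "card (?sh F0 \<inter> ?sh F1) = card (insert a ` (?sh F0 \<inter> ?sh F1))"
  proof -
    have "inj_on (insert a) (?sh F0 \<inter> ?sh F1)"
      using insert.hyps(2)
      by (intro inj_onI) (metis (mono_tags, lifting) Diff_insert_absorb IntE mem_Collect_eq subsetD)
    thus ?thesis
      by (rule card_image[symmetric])
  qed
  also have "card (?sh F0 \<union> ?sh F1) + \<dots> = card ((?sh F0 \<union> ?sh F1) \<union> insert a ` (?sh F0 \<inter> ?sh F1))"
  proof (rule card_Un_disjoint[symmetric])
    show "finite (?sh F0 \<union> ?sh F1)" "finite (insert a ` (?sh F0 \<inter> ?sh F1))"
      using insert.hyps(1) by auto
    show "(?sh F0 \<union> ?sh F1) \<inter> insert a ` (?sh F0 \<inter> ?sh F1) = {}"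
      using insert.hyps(2) by blast
  qed
  also have "\<dots> \<le> card {S. S \<subseteq> insert a X \<and> shatters F S}"
  proof (rule card_mono)
    show "finite {S. S \<subseteq> insert a X \<and> shatters F S}"
      using insert.hyps(1) by simp
    have 1: "shatters F S" if S: "S \<subseteq> X" "shatters F1 S" for S
      unfolding shatters_def
    proof (intro allI impI)
      fix Y assume "Y \<subseteq> S"
      then obtain Z where "Z \<in> F" "(Z - {a}) \<inter> S = Y"
        using S(2) unfolding shatters_def F1_def by blast
      moreover from this have "Z \<inter> S = Y"
        using S(1) insert.hyps(2) by blast
      ultimately show "\<exists>Z\<in>F. Z \<inter> S = Y"
        by blast
    qed
    have 2: "shatters F S" if "shatters F0 S" for S
      using that by (rule shatters_mono) (auto simp: F0_def)
    have 3: "shatters F (insert a S)" if S: "S \<subseteq> X" "shatters F0 S" "shatters F1 S" for S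
      unfolding shatters_def
    proof (intro allI impI)
      fix Y assume Y: "Y \<subseteq> insert a S"
      have "Y - {a} \<subseteq> S"
        using Y by blast
      then obtain Z0 Z1 where Z0: "Z0 \<in> F0" "Z0 \<inter> S = Y - {a}" and
          Z1: "Z1 \<in> F1" "Z1 \<inter> S = Y - {a}"
        using S(2,3) unfolding shatters_def by meson
      then obtain Z where Z: "Z \<in> F" "a \<in> Z" "Z1 = Z - {a}"
        unfolding F1_def by blast
      have aS: "a \<notin> S"
        using S(1) insert.hyps(2) by blast
      show "\<exists>Z\<in>F. Z \<inter> insert a S = Y"
      proof (cases "a \<in> Y")
        case True
        have "Z \<inter> insert a S = insert a (Z1 \<inter> S)"
          using Z(2,3) aS by blast
        also have "\<dots> = Y"
          using True by (simp add: Z1(2) insert_absorb)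
        finally have "Z \<inter> insert a S = Y" .
        thus ?thesis
          using Z(1) by blast
      next
        case False
        hence "Y - {a} = Y"
          by simp
        moreover have "a \<notin> Z0" "Z0 \<in> F"
          using Z0(1) by (simp_all add: F0_def)
        ultimately have "Z0 \<inter> insert a S = Y"
          using Z0(2) by simp
        thus ?thesis
          using \<open>Z0 \<in> F\<close> by blast
      qed
    qed
    show "(?sh F0 \<union> ?sh F1) \<union> insert a ` (?sh F0 \<inter> ?sh F1) \<subseteq>
        {S. S \<subseteq> insert a X \<and> shatters F S}"
      using 1 2 3 by blast
  qed
  finally show ?case .
qed

section \<open>Exponential bound on the number of small subsets\<close>

lemma sum_Pow_power_card:
  fixes x :: real
  assumes "finite X"
  shows "(\<Sum>S\<in>Pow X. x ^ card S) = (1 + x) ^ card X"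
  using assms
proof (induction X rule: finite_induct)
  case (insert a X)
  have "(\<Sum>S\<in>Pow (insert a X). x ^ card S) =
      (\<Sum>S\<in>Pow X. x ^ card S) + (\<Sum>S\<in>insert a ` Pow X. x ^ card S)"
    unfolding Pow_insert using insert.hyps by (intro sum.union_disjoint) auto
  also have "(\<Sum>S\<in>insert a ` Pow X. x ^ card S) = (\<Sum>S\<in>Pow X. x ^ card (insert a S))"
    using insert.hyps by (subst sum.reindex) (auto simp: inj_on_def)
  also have "\<dots> = (\<Sum>S\<in>Pow X. x * x ^ card S)"
  proof (rule sum.cong)
    fix S assume "S \<in> Pow X"
    hence "a \<notin> S" "finite S"
      using insert.hyps finite_subset by auto
    thus "x ^ card (insert a S) = x * x ^ card S"
      by simp
  qed simp
  finally show ?case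
    using insert by (simp add: algebra_simps flip: sum_distrib_left)
qed simp

text \<open>A Chernoff-type argument: give each subset \<open>S\<close> the weight
  \<open>x ^ card S\<close>. Every small subset weighs at least 2 powr (-\<epsilon>/2 |X|), while
  the total weight (1 + x) ^ |X| is at most 2 powr (\<epsilon>/2 |X|).\<close>

lemma card_small_subsets_le:
  fixes \<epsilon> :: real
  assumes "\<epsilon> > 0"
  obtains \<delta> :: real where "\<delta> > 0" "\<And>X :: 'a set. finite X \<Longrightarrow>
    card {S. S \<subseteq> X \<and> card S \<le> \<delta> * card X} \<le> 2 powr (\<epsilon> * card X)"
proof -
  \<comment> \<open>The first bound gives 1 + x \<le> 2 powr (\<epsilon>/2); the cap 1/2 makes
    \<open>log 2 x\<close> negative. Then \<delta> is the solution of x powr \<delta> = 2 powr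
    (-\<epsilon>/2).\<close>
  define x where "x = min (2 powr (\<epsilon> / 2) - 1) (1 / 2)"
  define \<delta> where "\<delta> = - (\<epsilon> / 2) / log 2 x"
  have x: "0 < x" "x < 1" "1 + x \<le> 2 powr (\<epsilon> / 2)"
    using assms by (auto simp: x_def)
  have l: "log 2 x < 0"
    using x by simp
  hence "\<delta> > 0"
    unfolding \<delta>_def using assms by (intro divide_neg_neg) simp_all
  have "x powr \<delta> = 2 powr (log 2 x * \<delta>)"
    using x by (simp flip: powr_powr)
  also have "log 2 x * \<delta> = - (\<epsilon> / 2)"
    using l by (simp add: \<delta>_def)
  finally have x\<delta>: "x powr \<delta> = 2 powr - (\<epsilon> / 2)" .
  have "card {S. S \<subseteq> X \<and> card S \<le> \<delta> * card X} \<le> 2 powr (\<epsilon> * card X)"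
    if X: "finite X" for X :: "'a set"
  proof -
    let ?n = "real (card X)" and ?A = "{S. S \<subseteq> X \<and> card S \<le> \<delta> * card X}"
    have "x powr (\<delta> * ?n) = (x powr \<delta>) powr ?n"
      by (simp add: powr_powr)
    also have "\<dots> = 2 powr - (\<epsilon> / 2 * ?n)"
      unfolding x\<delta> by (simp add: powr_powr)
    finally have "card ?A * 2 powr - (\<epsilon> / 2 * ?n) = (\<Sum>S\<in>?A. x powr (\<delta> * ?n))"
      by simp
    also have "\<dots> \<le> (\<Sum>S\<in>?A. x ^ card S)"
      using x by (intro sum_mono) (simp add: powr_mono' flip: powr_realpow)
    also have "\<dots> \<le> (\<Sum>S\<in>Pow X. x ^ card S)"
      using x X by (intro sum_mono2) auto
    also have "\<dots> = (1 + x) ^ card X"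
      using X by (rule sum_Pow_power_card)
    also have "\<dots> \<le> (2 powr (\<epsilon> / 2)) ^ card X"
      using x by (intro power_mono) auto
    also have "\<dots> = 2 powr (\<epsilon> / 2 * ?n)"
      by (simp add: powr_powr flip: powr_realpow)
    finally have "card ?A * 2 powr - (\<epsilon> / 2 * ?n) * 2 powr (\<epsilon> / 2 * ?n) \<le>
        2 powr (\<epsilon> / 2 * ?n) * 2 powr (\<epsilon> / 2 * ?n)"
      by (rule mult_right_mono) simp
    thus ?thesis
      by (simp add: powr_minus field_simps flip: powr_add)
  qed
  thus ?thesis
    using \<open>\<delta> > 0\<close> that by blast
qed

section \<open>Matroid properties and extensions\<close>

lemma linear_injectionI_subspace:
  assumes "additive_inj_on \<phi> W" "insert 0 V \<subseteq> W" "0 \<notin> V" "\<phi> ` V \<subseteq> insert 0 V'"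
  shows "linear_injection \<phi> V V'"
proof (rule linear_injectionI)
  show *: "additive_inj_on \<phi> (insert 0 V)"
    using assms(1,2) by (rule additive_inj_on_subset)
  fix x assume x: "x \<in> V"
  have "\<phi> x \<noteq> \<phi> 0"
    using * x assms(3) unfolding additive_inj_on_def inj_on_def by (metis insertCI)
  hence "\<phi> x \<noteq> 0"
    using additive_inj_on_0[OF *] by simp
  thus "\<phi> x \<in> V'"
    using x assms(4) by blast
qed

lemma pullback_in_property:
  assumes "matroid_property T" "hereditary T" "M \<in> T" "proj_space V" "linear_injection \<phi> V (dom M)"
  shows "(M \<circ> \<phi>) |` V \<in> T" "dom ((M \<circ> \<phi>) |` V) = V"
proof -
  have "0 \<notin> V"
    using assms(4) by (simp add: proj_space_iff)
  hence "\<phi> ` V \<subseteq> dom M"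
    using linear_injectionD(2)[OF assms(5)] by simp
  thus dom: "dom ((M \<circ> \<phi>) |` V) = V"
    by (force simp: restrict_map_def split: if_splits)
  show "(M \<circ> \<phi>) |` V \<in> T"
    using assms(4,5)
    by (intro matroid_property_pullback[OF assms(1-3), of _ \<phi>])
      (simp_all add: dom is_matroid_def del: dom_restrict)
qed

text \<open>Non-triviality only gives a member of dimension at least \<open>n\<close>; pulling it
  back along an embedding of the standard space yields dimension exactly \<open>n\<close>.\<close>

lemma nontrivial_std_space:
  assumes "matroid_property T" "hereditary T" "nontrivial T"
  obtains M where "M \<in> T" "dom M = std_space n"
proof -
  obtain M where M: "M \<in> T" "n \<le> mdim M"
    using assms(3) unfolding nontrivial_def by blast
  hence V: "proj_space (dom M)"
    using assms(1) unfolding matroid_property_def is_matroid_def by blast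
  have "card (vecs n) \<le> card (insert 0 (dom M))"
    unfolding card_vecs card_proj_space[OF V] using M(2) by (simp add: mdim_def)
  then obtain \<phi> where \<phi>: "additive_inj_on \<phi> (vecs n)" "\<phi> ` vecs n \<subseteq> insert 0 (dom M)"
    using ex_additive_inj_on[of "vecs n" "insert 0 (dom M)"] V f2_subspace_vecs finite_vecs
    unfolding proj_space_iff by (meson finite_insert)
  have "linear_injection \<phi> (std_space n) (dom M)"
    using \<phi> by (intro linear_injectionI_subspace[of \<phi> "vecs n"]) (auto simp: std_space_eq f2.subspace_0[OF f2_subspace_vecs])
  thus ?thesis
    using pullback_in_property[OF assms(1,2) M(1) proj_space_std_space] that by blast
qed

section \<open>Small codimension and matroids constant on a subspace\<close>

lemma codim_0_eq:
  assumes "proj_subspace U V" "proj_space V" "codim U V = 0"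
  shows "U = V"
proof -
  have U: "proj_space U" "U \<subseteq> V"
    using assms(1) by (auto simp: proj_subspace_def)
  have "pdim U = pdim V"
    using pdim_mono[OF U(1) assms(2) U(2)] assms(3) by (simp add: codim_def)
  hence "card (insert 0 U) = card (insert 0 V)"
    using U assms by (simp add: card_proj_space)
  hence "insert 0 U = insert 0 V"
    using U assms(2) by (intro card_subset_eq) (auto simp: proj_space_iff)
  moreover have "0 \<notin> U" "0 \<notin> V"
    using U assms(2) by (auto simp: proj_space_iff)
  ultimately show ?thesis
    by (rule insert_ident[THEN iffD1, rotated -1])
qed

text \<open>Lets codimensions 0 and 1 be treated alike. In codimension 1, \<open>a\<close> is taken
  in \<open>V\<close> outside \<open>U\<close> and the two cosets fill the space by cardinality. If
  U = V, then \<open>a\<close> is any vector outside, and the inclusion is proper.\<close>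

lemma codim_le_1_cover:
  assumes "proj_subspace U V" "proj_space V" "codim U V \<le> 1"
  obtains a where "a \<notin> insert 0 U" "insert 0 V \<subseteq> insert 0 U \<union> (+) a ` insert 0 U"
    "codim U V = 1 \<Longrightarrow> insert 0 V = insert 0 U \<union> (+) a ` insert 0 U"
proof (cases "U = V")
  case True
  have "finite (insert 0 U)"
    using assms by (simp add: proj_subspace_def proj_space_iff)
  then obtain a where "a \<notin> insert 0 U"
    using ex_not_in_finite by blast
  thus ?thesis
    using that[of a] True by (auto simp: codim_def)
next
  case False
  let ?H = "insert 0 U"
  have U: "proj_space U" "U \<subseteq> V" "f2.subspace ?H" "finite ?H"
    using assms(1) by (auto simp: proj_subspace_def proj_space_iff)
  have V: "f2.subspace (insert 0 V)" "finite (insert 0 V)"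
    using assms(2) by (auto simp: proj_space_iff)
  obtain a where a: "a \<in> insert 0 V" "a \<notin> ?H"
    using False U assms(2) by (auto simp: proj_space_iff)
  have sub: "?H \<union> (+) a ` ?H \<subseteq> insert 0 V"
    using U(2) V(1) a(1) by (auto simp: f2_subspace_iff)
  have "pdim V \<le> Suc (pdim U)"
    using assms(3) by (simp add: codim_def)
  hence "(2::nat) ^ pdim V \<le> 2 ^ Suc (pdim U)"
    by (intro power_increasing) auto
  hence "card (insert 0 V) \<le> card (?H \<union> (+) a ` ?H)"
    using f2_card_double[OF U(3,4) a(2)] assms(2) U(1) by (simp add: card_proj_space)
  hence "?H \<union> (+) a ` ?H = insert 0 V"
    using V(2) sub by (intro card_seteq) auto
  thus ?thesis
    using that[of a] a(2) by simp
qed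

text \<open>The constant matroid that is extended can be taken to be the restriction of
  \<open>N\<close> to \<open>U\<close>; the dimension bound in \<open>Ext\<close> then becomes the
  codimension bound.\<close>

lemma ext_const_iff:
  "N \<in> ext_const k i \<longleftrightarrow> is_matroid N \<and>
    (\<exists>U. proj_subspace U (dom N) \<and> codim U (dom N) \<le> k \<and> (\<forall>x\<in>U. N x = Some i))"
proof
  assume "N \<in> ext_const k i"
  then obtain M where M: "M \<in> const_matroids i" "N \<in> Ext k M"
    unfolding ext_const_def Ext_property_def by blast
  then obtain U where U: "is_matroid N" "proj_subspace U (dom N)" "codim U (dom N) \<le> k"
      "isomorphic M (N |` U)"
    unfolding Ext_def by blast
  have "dom (N |` U) = U"
    using U(2) unfolding proj_subspace_def by auto
  then obtain \<phi> where "\<phi> ` dom M = U" "\<forall>x\<in>dom M. M x = (N |` U) (\<phi> x)"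
    using U(4) unfolding isomorphic_def by metis
  hence "\<forall>x\<in>U. N x = Some i"
    using M(1) unfolding const_matroids_def by (force simp: restrict_map_def)
  thus "is_matroid N \<and> (\<exists>U. proj_subspace U (dom N) \<and> codim U (dom N) \<le> k \<and> (\<forall>x\<in>U. N x = Some i))"
    using U by blast
next
  assume "is_matroid N \<and> (\<exists>U. proj_subspace U (dom N) \<and> codim U (dom N) \<le> k \<and> (\<forall>x\<in>U. N x = Some i))"
  then obtain U where U: "is_matroid N" "proj_subspace U (dom N)" "codim U (dom N) \<le> k"
      "\<forall>x\<in>U. N x = Some i"
    by blast
  have dom: "dom (N |` U) = U"
    using U(2) unfolding proj_subspace_def by auto
  have "N |` U \<in> const_matroids i"
    using U(2,4) dom unfolding const_matroids_def is_matroid_def proj_subspace_def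
    by (simp add: restrict_map_def)
  moreover have "isomorphic (N |` U) (N |` U)"
    unfolding isomorphic_def
    by (rule exI[of _ id]) (auto intro!: linear_injectionI simp: additive_inj_on_def)
  hence "N \<in> Ext k (N |` U)"
    using U(1-3) dom unfolding Ext_def mdim_def codim_def by (auto simp del: dom_restrict)
  ultimately show "N \<in> ext_const k i"
    unfolding ext_const_def Ext_property_def by blast
qed

text \<open>Normal form of an affine pattern: stars on \<open>H\<close> without 0, and entries 0 or
  1 on the coset a + H.\<close>

lemma affine_patternE:
  assumes "affine_pattern A"
  obtains H a where "f2.subspace H" "finite H" "a \<notin> H" "insert 0 (dom A) = H \<union> (+) a ` H"
    "{x. A x = Some Star} = H - {0}" "0 \<notin> dom A"
proof -
  let ?U = "{x. A x = Some Star}"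
  have A: "proj_space (dom A)" "proj_subspace ?U (dom A)" "codim ?U (dom A) = 1"
    using assms by (auto simp: affine_pattern_def k_affine_def is_pattern_def)
  obtain a where a: "a \<notin> insert 0 ?U" "insert 0 (dom A) = insert 0 ?U \<union> (+) a ` insert 0 ?U"
    using codim_le_1_cover[OF A(2,1)] A(3) by auto
  have U: "f2.subspace (insert 0 ?U)" "finite (insert 0 ?U)" "0 \<notin> ?U"
    using A(2) unfolding proj_subspace_def proj_space_iff by auto
  show ?thesis
    by (rule that[OF U(1,2) a]) (use U A(1) in \<open>auto simp: proj_space_iff\<close>)
qed

section \<open>Constant restrictions of matroids, and filling in the stars of a pattern\<close>

lemma matroid_Ramsey:
  obtains m where "\<And>M :: matroid. std_space m \<subseteq> dom M \<Longrightarrow>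
    \<exists>D i. D \<subseteq> vecs m \<and> f2.subspace D \<and> card D = 2 ^ d \<and> (\<forall>x\<in>D - {0}. M x = Some i)"
proof -
  obtain m where m: "\<And>P. \<exists>D\<subseteq>vecs m. f2.subspace D \<and> card D = 2 ^ d \<and>
      ((\<forall>x\<in>D - {0}. P x) \<or> (\<forall>x\<in>D - {0}. \<not> P x))"
    using subspace_Ramsey by blast
  have "\<exists>D i. D \<subseteq> vecs m \<and> f2.subspace D \<and> card D = 2 ^ d \<and> (\<forall>x\<in>D - {0}. M x = Some i)"
    if M: "std_space m \<subseteq> dom M" for M :: matroid
  proof -
    obtain D where D: "D \<subseteq> vecs m" "f2.subspace D" "card D = 2 ^ d"
        and mono: "(\<forall>x\<in>D - {0}. M x = Some 0) \<or> (\<forall>x\<in>D - {0}. M x \<noteq> Some 0)"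
      using m[of "\<lambda>x. M x = Some 0"] by blast
    have "D - {0} \<subseteq> dom M"
      using D(1) M unfolding std_space_eq by blast
    hence "M x = Some 0 \<or> M x = Some 1" if "x \<in> D - {0}" for x
      using that by (metis (full_types) bit_not_one_iff domD subsetD)
    then obtain i where "\<forall>x\<in>D - {0}. M x = Some i"
      using mono by metis
    thus ?thesis
      using D by blast
  qed
  thus ?thesis
    using that by blast
qed

text \<open>Guarantees that the value 0 is attained in the definition of the critical number. If a
  constant matroid of each value were missing from \<open>T\<close>, a monochromatic subspace in a
  large member of \<open>T\<close> would contain a copy of one of them.\<close>

lemma const_matroids_subset_property:
  assumes T: "matroid_property T" "hereditary T" "nontrivial T"
  shows "\<exists>i. ext_const 0 i \<subseteq> T"
proof (rule ccontr)
  assume "\<nexists>i. ext_const 0 i \<subseteq> T"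
  hence "\<forall>i. \<exists>N. N \<in> ext_const 0 i \<and> N \<notin> T"
    by blast
  then obtain N where N: "\<And>i. N i \<in> ext_const 0 i" "\<And>i. N i \<notin> T"
    by metis
  have V: "proj_space (dom (N i))" and const: "\<forall>x\<in>dom (N i). N i x = Some i" for i
  proof -
    show V: "proj_space (dom (N i))"
      using N(1)[of i] by (simp add: ext_const_iff is_matroid_def)
    obtain U where "proj_subspace U (dom (N i))" "codim U (dom (N i)) = 0" "\<forall>x\<in>U. N i x = Some i"
      using N(1)[of i] unfolding ext_const_iff by auto
    thus "\<forall>x\<in>dom (N i). N i x = Some i"
      using codim_0_eq[OF _ V] by blast
  qed
  \<comment> \<open>The colour \<open>i\<close> is known only after Ramsey is applied, so
    \<open>d\<close> bounds both dimensions.\<close>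
  define d where "d = pdim (dom (N 0)) + pdim (dom (N 1))"
  have d: "pdim (dom (N i)) \<le> d" for i
    by (cases i) (simp_all add: d_def)
  obtain m where m: "\<And>M :: matroid. std_space m \<subseteq> dom M \<Longrightarrow>
      \<exists>D i. D \<subseteq> vecs m \<and> f2.subspace D \<and> card D = 2 ^ d \<and> (\<forall>x\<in>D - {0}. M x = Some i)"
    using matroid_Ramsey by blast
  obtain M where M: "M \<in> T" "dom M = std_space m"
    using nontrivial_std_space[OF T] by blast
  obtain D i where D: "D \<subseteq> vecs m" "f2.subspace D" "card D = 2 ^ d"
      and i: "\<forall>x\<in>D - {0}. M x = Some i"
    using m[of M] M(2) by blast
  have "D - {0} \<subseteq> dom M"
    using i by blast
  have "card (insert 0 (dom (N i))) \<le> card D"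
    using d by (simp add: card_proj_space[OF V] D(3))
  moreover have "f2.subspace (insert 0 (dom (N i)))" "finite (insert 0 (dom (N i)))"
    using V[of i] by (simp_all add: proj_space_iff)
  ultimately obtain \<phi> where \<phi>: "additive_inj_on \<phi> (insert 0 (dom (N i)))" "\<phi> ` insert 0 (dom (N i)) \<subseteq> D"
    using ex_additive_inj_on D(2) finite_subset[OF D(1) finite_vecs] by blast
  have 0: "0 \<notin> dom (N i)"
    using V[of i] by (simp add: proj_space_iff)
  have inj: "linear_injection \<phi> (dom (N i)) (D - {0})"
    using \<phi> 0 by (intro linear_injectionI_subspace[OF \<phi>(1)]) auto
  have "N i \<in> T"
  proof (rule matroid_property_pullback[OF T(1,2) M(1)])
    show "is_matroid (N i)"
      using V by (simp add: is_matroid_def)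
    show "linear_injection \<phi> (dom (N i)) (dom M)"
      using linear_injectionD[OF inj 0] \<open>D - {0} \<subseteq> dom M\<close> by (intro linear_injectionI) blast+
    show "N i x = M (\<phi> x)" if "x \<in> dom (N i)" for x
    proof -
      have "\<phi> x \<in> D - {0}"
        using linear_injectionD(2)[OF inj 0] that by blast
      thus ?thesis
        using i const[of i] that by metis
    qed
  qed
  thus False
    using N(2) by blast
qed

text \<open>Replacing every star of \<open>A\<close> by \<open>i\<close> gives a matroid constant on
  a hyperplane, and the identity is an instance of \<open>A\<close> in it.\<close>

lemma not_ext_const_subset_if_free:
  assumes A: "affine_pattern A" "\<forall>M\<in>T. pattern_free A M" and k: "k \<ge> 1"
  shows "\<not> ext_const k i \<subseteq> T"
proof
  assume sub: "ext_const k i \<subseteq> T"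
  define M :: matroid where "M = map_option (\<lambda>v. case v of Val b \<Rightarrow> b | Star \<Rightarrow> i) \<circ> A"
  have dom: "dom M = dom A"
    by (auto simp: M_def dom_def)
  let ?U = "{x. A x = Some Star}"
  have "proj_space (dom A)" "proj_subspace ?U (dom A)" "codim ?U (dom A) = 1"
    using A by (auto simp: affine_pattern_def k_affine_def is_pattern_def)
  moreover have "\<forall>x\<in>?U. M x = Some i"
    by (simp add: M_def)
  ultimately have "M \<in> ext_const k i"
    unfolding ext_const_iff is_matroid_def dom using k by (metis (no_types, lifting))
  moreover have "is_instance A M id"
    unfolding is_instance_def dom
    by (auto intro!: linear_injectionI simp: additive_inj_on_def M_def)
  ultimately show False
    using A(2) sub unfolding pattern_free_def by blast
qed

section \<open>Counting\<close>

text \<open>Passing to the sets of vectors of value 1 makes the slice a set system, to which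
  shattering applies.\<close>

lemma inj_on_slice: "inj_on (\<lambda>M. {v. M v = Some 1}) (slice T n)"
proof (rule inj_onI)
  fix M M' assume M: "M \<in> slice T n" "M' \<in> slice T n" and eq: "{v. M v = Some 1} = {v. M' v = Some 1}"
  hence dom: "dom M = dom M'"
    by (simp add: slice_def)
  show "M = M'"
  proof
    fix v
    have "M v = None \<longleftrightarrow> M' v = None" "M v = Some 1 \<longleftrightarrow> M' v = Some 1"
      using dom eq by blast+
    thus "M v = M' v"
      by (metis (full_types) bit_not_one_iff not_None_eq)
  qed
qed

lemma slice_image_subset: "(\<lambda>M. {v. M v = Some 1}) ` slice T n \<subseteq> Pow (std_space n)"
  by (auto simp: slice_def)

lemma finite_slice: "finite (slice T n)"
proof (rule finite_imageD[OF _ inj_on_slice])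
  show "finite ((\<lambda>M. {v. M v = Some 1}) ` slice T n)"
    using slice_image_subset by (rule finite_subset) (simp add: finite_std_space)
qed

text \<open>Fixing the value \<open>i\<close> on the hyperplane leaves the values at the 2 ^ n
  vectors off it free, which gives 2 ^ 2 ^ n members of the slice.\<close>

lemma h_ge_if_ext_const_subset:
  assumes "ext_const k i \<subseteq> T" "k \<ge> 1"
  shows "h (Suc n) T \<ge> 2 ^ n"
proof -
  let ?E = "vecs (Suc n) - vecs n"
  define f :: "f2vec set \<Rightarrow> matroid" where
    "f S = (\<lambda>v. Some (if v \<in> vecs n then i else of_bool (v \<in> S))) |` std_space (Suc n)" for S
  have sub: "vecs n \<subseteq> vecs (Suc n)"
    by (auto simp: vecs_def)
  hence sub': "std_space n \<subseteq> std_space (Suc n)"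
    by (auto simp: std_space_eq)
  have dom: "dom (f S) = std_space (Suc n)" for S
    by (auto simp: f_def restrict_map_def split: if_splits)
  have "proj_subspace (std_space n) (std_space (Suc n))" "codim (std_space n) (std_space (Suc n)) = 1"
    using sub' by (simp_all add: proj_subspace_def proj_space_std_space codim_def pdim_std_space)
  moreover have "\<forall>x\<in>std_space n. f S x = Some i" for S
    using sub' by (auto simp: f_def std_space_eq)
  ultimately have "f S \<in> ext_const k i" for S
    unfolding ext_const_iff is_matroid_def dom using assms(2)
    by (intro conjI exI[of _ "std_space n"]) (simp_all add: proj_space_std_space)
  hence "f ` Pow ?E \<subseteq> slice T (Suc n)"
    using assms(1) dom unfolding slice_def by blast
  moreover have "inj_on f (Pow ?E)"
  proof (rule inj_onI)
    fix S S' assume S: "S \<in> Pow ?E" "S' \<in> Pow ?E" "f S = f S'"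
    have "v \<in> S \<longleftrightarrow> v \<in> S'" if "v \<in> ?E" for v
    proof -
      have "v \<noteq> 0"
        using that f2.subspace_0[OF f2_subspace_vecs, of n] by blast
      hence "v \<in> std_space (Suc n)" "v \<notin> vecs n"
        using that by (simp_all add: std_space_eq)
      thus ?thesis
        using fun_cong[OF S(3), of v] by (simp add: f_def of_bool_def split: if_splits)
    qed
    thus "S = S'"
      using S(1,2) by blast
  qed
  ultimately have "card (Pow ?E) \<le> card (slice T (Suc n))"
    using finite_slice card_inj_on_le by blast
  moreover have "card ?E = 2 ^ n"
    using sub finite_vecs by (simp add: card_Diff_subset card_vecs)
  hence "card (Pow ?E) = 2 ^ 2 ^ n"
    using finite_vecs by (simp add: card_Pow)
  ultimately have "(2::nat) ^ 2 ^ n \<le> card (slice T (Suc n))"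
    by simp
  hence "real (2 ^ 2 ^ n) \<le> real (card (slice T (Suc n)))"
    by (rule of_nat_mono)
  hence "log 2 (2 ^ 2 ^ n) \<le> h (Suc n) T"
    unfolding h_def by (intro log_mono) auto
  thus ?thesis
    by (simp add: log_nat_power)
qed

lemma not_ext_const_subset_if_h_small:
  assumes "(\<lambda>n. h n T) \<in> o(\<lambda>n. 2 ^ n)" "k \<ge> 1"
  shows "\<not> ext_const k i \<subseteq> T"
proof
  assume sub: "ext_const k i \<subseteq> T"
  \<comment> \<open>With factor 1/4 the bound at \<open>Suc n\<close> is half of 2 ^ n,
    contradicting the lower bound 2 ^ n.\<close>
  have "eventually (\<lambda>n. norm (h n T) \<le> 1 / 4 * norm ((2::real) ^ n)) at_top"
    using assms(1) by (rule landau_o.smallD) simp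
  then obtain n where "norm (h (Suc n) T) \<le> 1 / 4 * norm ((2::real) ^ Suc n)"
    unfolding eventually_at_top_linorder by (meson le_SucI order_refl)
  moreover have "2 ^ n \<le> h (Suc n) T"
    using sub assms(2) by (rule h_ge_if_ext_const_subset)
  moreover have "(0::real) < 2 ^ n"
    by simp
  ultimately show False
    by simp
qed

text \<open>Embed the star subspace into \<open>D\<close> and send \<open>a\<close> to
  \<open>x\<close>. The non-star entries then land in the shattered coset x + D, so some member of
  the slice takes the prescribed values there.\<close>

lemma affine_pattern_instance:
  assumes A: "affine_pattern A" "card (insert 0 {x. A x = Some Star}) \<le> card D"
    and D: "f2.subspace D" "D \<subseteq> vecs n"
    and x: "x \<in> vecs n" "x \<notin> D"
    and shattered: "shatters ((\<lambda>M. {v. M v = Some 1}) ` slice T n) ((+) x ` D)"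
  shows "\<exists>M\<in>T. \<not> pattern_free A M"
proof -
  obtain H a where H: "f2.subspace H" "finite H" "a \<notin> H" "insert 0 (dom A) = H \<union> (+) a ` H"
      "{x. A x = Some Star} = H - {0}" "0 \<notin> dom A"
    using affine_patternE[OF A(1)] by metis
  have "card H \<le> card D"
    using A(2) H(5) f2.subspace_0[OF H(1)] by (simp add: insert_absorb)
  then obtain \<phi> where \<phi>: "additive_inj_on \<phi> H" "\<phi> ` H \<subseteq> D"
    using ex_additive_inj_on[OF H(1,2) D(1)] finite_subset[OF D(2) finite_vecs] by blast
  have "x \<notin> \<phi> ` H"
    using \<phi>(2) x(2) by blast
  then obtain \<psi> where \<psi>: "additive_inj_on \<psi> (H \<union> (+) a ` H)" "\<And>u. u \<in> H \<Longrightarrow> \<psi> u = \<phi> u"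
      "\<And>u. u \<in> H \<Longrightarrow> \<psi> (a + u) = x + \<phi> u"
    using additive_inj_on_double[OF \<phi>(1) H(1,3)] by metis
  let ?S = "(+) x ` D"
  have xD: "D \<subseteq> vecs n" "?S \<subseteq> vecs n"
    using D(2) x(1) f2_subspace_vecs[of n] by (auto simp: f2_subspace_iff)
  have im: "\<psi> ` (H \<union> (+) a ` H) \<subseteq> vecs n"
  proof -
    have "\<psi> u \<in> vecs n \<and> \<psi> (a + u) \<in> vecs n" if "u \<in> H" for u
    proof -
      have "\<phi> u \<in> D"
        using \<phi>(2) that by blast
      thus ?thesis
        unfolding \<psi>(2)[OF that] \<psi>(3)[OF that] using xD by blast
    qed
    thus ?thesis
      by blast
  qed
  have val: "\<psi> v \<in> ?S" if "A v = Some (Val b)" for v b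
  proof -
    have vA: "v \<in> dom A" "A v \<noteq> Some Star"
      using that by auto
    have "v \<in> H \<union> (+) a ` H"
      using vA(1) H(4)[symmetric] by simp
    moreover have "v \<noteq> 0"
      using vA(1) H(6) by metis
    hence "v \<notin> H"
      using vA(2) H(5) by blast
    ultimately obtain u where "u \<in> H" "v = a + u"
      by blast
    thus ?thesis
      using \<psi>(3) \<phi>(2) by blast
  qed
  \<comment> \<open>Prescribes the vectors of value 1 on the coset. By injectivity the entries 0 are
    mapped outside \<open>?Y\<close>, and there the member, being defined, has value 0.\<close>
  let ?Y = "\<psi> ` {v. A v = Some (Val 1)}"
  have "?Y \<subseteq> ?S"
    using val by blast
  then obtain Z where Z: "Z \<in> (\<lambda>M. {v. M v = Some 1}) ` slice T n" "Z \<inter> ?S = ?Y"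
    using shattered unfolding shatters_def by meson
  then obtain M where M: "M \<in> slice T n" "{v. M v = Some 1} \<inter> ?S = ?Y"
    by blast
  have dom: "dom M = std_space n"
    using M(1) by (simp add: slice_def)
  have inj: "linear_injection \<psi> (dom A) (dom M)"
  proof (rule linear_injectionI_subspace[OF \<psi>(1) _ H(6)])
    show "insert 0 (dom A) \<subseteq> H \<union> (+) a ` H"
      by (simp only: H(4))
    have "dom A \<subseteq> H \<union> (+) a ` H"
      unfolding H(4)[symmetric] by blast
    thus "\<psi> ` dom A \<subseteq> insert 0 (dom M)"
      using im unfolding dom insert_0_std_space by blast
  qed
  have "M (\<psi> v) = Some b" if v: "A v = Some (Val b)" for v b
  proof -
    have vd: "v \<in> dom A"
      using v by blast
    have "\<psi> v \<in> dom M"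
      using linear_injectionD(2)[OF inj H(6)] vd by blast
    moreover have "\<psi> v \<in> ?Y \<longleftrightarrow> b = 1"
    proof
      assume "\<psi> v \<in> ?Y"
      then obtain w where w: "A w = Some (Val 1)" "\<psi> v = \<psi> w"
        by blast
      hence "v = w"
        using linear_injectionD(1)[OF inj H(6)] vd unfolding additive_inj_on_def inj_on_def
        by (metis domI insertCI)
      thus "b = 1"
        using w v by simp
    qed (use v in blast)
    hence "M (\<psi> v) = Some 1 \<longleftrightarrow> b = 1"
      using M(2) val[OF v] by blast
    ultimately show ?thesis
      by (metis (full_types) bit_not_one_iff domD)
  qed
  hence "is_instance A M \<psi>"
    using inj by (simp add: is_instance_def)
  thus ?thesis
    using M(1) unfolding pattern_free_def slice_def by blast
qed

text \<open>A dense shattered set would contain a coset x + D, shattered as well, and hence give an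
  instance of \<open>A\<close>. So only small sets are shattered, and their number bounds the size
  of the slice.\<close>

lemma h_small_if_free:
  assumes A: "affine_pattern A" "\<forall>M\<in>T. pattern_free A M"
  shows "(\<lambda>n. h n T) \<in> o(\<lambda>n. 2 ^ n)"
proof (rule landau_o.smallI)
  fix \<epsilon> :: real assume "\<epsilon> > 0"
  then obtain \<delta> :: real where \<delta>: "\<delta> > 0" "\<And>X :: f2vec set. finite X \<Longrightarrow>
      card {S. S \<subseteq> X \<and> card S \<le> \<delta> * card X} \<le> 2 powr (\<epsilon> * card X)"
    by (rule card_small_subsets_le) blast
  \<comment> \<open>Counts vectors instead of taking the dimension: a subspace with 2 ^ k elements
    has room for the star subspace because k < 2 ^ k.\<close>
  define k where "k = card (insert 0 {x. A x = Some Star})"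
  \<comment> \<open>Half of \<delta> suffices because density is passed from the nonzero vectors to
    all of \<open>vecs n\<close>; for n \<ge> 1, which \<open>Suc N\<close> ensures below, at least
    half of the vectors are nonzero.\<close>
  have "\<delta> / 2 > 0"
    using \<delta>(1) by simp
  then obtain N where N: "\<And>W S. f2.subspace W \<Longrightarrow> finite W \<Longrightarrow> N \<le> card W \<Longrightarrow> S \<subseteq> W \<Longrightarrow>
      \<delta> / 2 * card W \<le> card S \<Longrightarrow>
      \<exists>D x. D \<subseteq> W \<and> f2.subspace D \<and> card D = 2 ^ k \<and> x \<in> W \<and> (\<forall>d\<in>D. x + d \<in> S)"
    by (rule dense_contains_flat[of "\<delta> / 2" k]) blast
  have "norm (h n T) \<le> \<epsilon> * norm ((2::real) ^ n)" if n: "n \<ge> Suc N" for n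
  proof (cases "slice T n = {}")
    \<comment> \<open>For an empty slice, \<open>h n T\<close> is \<open>log 2 0\<close>, whose
      value is 0 by convention.\<close>
    case True
    thus ?thesis
      using \<open>\<epsilon> > 0\<close> by (simp add: h_def log_def)
  next
    case False
    let ?F = "(\<lambda>M. {v. M v = Some 1}) ` slice T n" and ?X = "std_space n"
    have "card (insert 0 ?X) = Suc (card ?X)"
      by (rule card_insert_disjoint) (simp_all add: std_space_eq finite_vecs)
    hence "2 ^ n = Suc (card ?X)"
      unfolding insert_0_std_space card_vecs .
    from arg_cong[OF this, of real] have cX: "real (card ?X) = 2 ^ n - 1"
      by simp
    have "(2::real) ^ 1 \<le> 2 ^ n"
      using n by (intro power_increasing) auto
    hence half: "real (card (vecs n)) / 2 \<le> card ?X"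
      unfolding cX by (simp add: card_vecs)
    have "N < 2 ^ N"
      by (rule less_exp)
    also have "(2::nat) ^ N \<le> 2 ^ n"
      using n by (intro power_increasing) auto
    finally have Nn: "N \<le> card (vecs n)"
      by (simp add: card_vecs)
    have small: "card S \<le> \<delta> * card ?X" if S: "S \<subseteq> ?X" "shatters ?F S" for S
    proof (rule ccontr)
      assume "\<not> ?thesis"
      moreover have "\<delta> * (real (card (vecs n)) / 2) \<le> \<delta> * card ?X"
        using half \<delta>(1) by (intro mult_left_mono) auto
      ultimately have "\<delta> / 2 * card (vecs n) \<le> card S"
        by simp
      moreover have "S \<subseteq> vecs n"
        using S(1) by (auto simp: std_space_eq)
      ultimately obtain D x where D: "D \<subseteq> vecs n" "f2.subspace D" "card D = 2 ^ k" "x \<in> vecs n"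
          "\<forall>d\<in>D. x + d \<in> S"
        using N[OF f2_subspace_vecs finite_vecs Nn, of S] by blast
      have "k \<le> card D"
        using D(3) less_exp[of k] by simp
      moreover have "x \<notin> D"
        using D(5) S(1) by (force simp: std_space_eq)
      moreover have "shatters ?F ((+) x ` D)"
        unfolding shatters_def
      proof (intro allI impI)
        fix Y assume Y: "Y \<subseteq> (+) x ` D"
        have sub: "(+) x ` D \<subseteq> S"
          using D(5) by blast
        then obtain Z where Z: "Z \<in> ?F" "Z \<inter> S = Y"
          using S(2) Y unfolding shatters_def by (meson order_trans)
        have "Z \<inter> (+) x ` D = Y"
          using Z(2) Y sub by blast
        thus "\<exists>Z\<in>?F. Z \<inter> (+) x ` D = Y"
          using Z(1) by blast
      qed
      ultimately show False
        using affine_pattern_instance[OF A(1) _ D(2,1,4)] A(2) unfolding k_def by blast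
    qed
    have "card (slice T n) = card ?F"
      using inj_on_slice by (rule card_image[symmetric])
    also have "\<dots> \<le> card {S. S \<subseteq> ?X \<and> shatters ?F S}"
      by (rule card_le_card_shattered[OF finite_std_space slice_image_subset])
    also have "\<dots> \<le> card {S. S \<subseteq> ?X \<and> card S \<le> \<delta> * card ?X}"
      using small finite_std_space by (intro card_mono) auto
    finally have "real (card (slice T n)) \<le> real (card {S. S \<subseteq> ?X \<and> card S \<le> \<delta> * card ?X})"
      by (rule of_nat_mono)
    also have "\<dots> \<le> 2 powr (\<epsilon> * card ?X)"
      using \<delta>(2) finite_std_space by blast
    also have "\<dots> \<le> 2 powr (\<epsilon> * 2 ^ n)"
      using \<open>\<epsilon> > 0\<close> by (intro powr_mono mult_left_mono) (auto simp: cX)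
    finally have le: "real (card (slice T n)) \<le> 2 powr (\<epsilon> * 2 ^ n)" .
    have "card (slice T n) > 0"
      using False finite_slice by (simp add: card_gt_0_iff)
    hence c: "1 \<le> real (card (slice T n))"
      by simp
    have "0 \<le> h n T"
      unfolding h_def using c by simp
    moreover have "h n T \<le> log 2 (2 powr (\<epsilon> * 2 ^ n))"
      unfolding h_def using c le by (intro log_mono) simp_all
    ultimately show ?thesis
      by simp
  qed
  thus "eventually (\<lambda>n. norm (h n T) \<le> \<epsilon> * norm ((2::real) ^ n)) at_top"
    unfolding eventually_at_top_linorder by blast
qed

section \<open>A universal affine pattern\<close>

text \<open>
  The affine part of the pattern consists of the vectors \<open>(y, q, 1)\<close> where \<open>q\<close> lists the values of an
  arbitrary function on \<open>vecs m\<close>, and the entry at \<open>(y, q, 1)\<close> is \<open>q y\<close>. Hence the coset of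
  \<open>vecs m\<close> through \<open>(0, p, 1)\<close> carries the function \<open>p\<close>.
\<close>

lemma universal_affine_pattern:
  obtains A n where "affine_pattern A" "dom A = std_space n" "vecs m \<subseteq> vecs n"
    "\<And>p. \<exists>x\<in>vecs n. x \<notin> vecs m \<and> (\<forall>u\<in>vecs m. A (x + u) = Some (Val (p u)))"
proof -
  obtain e where "bij_betw e (vecs m) {0..<card (vecs m)}"
    using ex_bij_betw_finite_nat[OF finite_vecs] by blast
  hence e: "inj_on e (vecs m)" "e u < 2 ^ m" if "u \<in> vecs m" for u
    using that by (auto simp: bij_betw_def card_vecs)
  \<comment> \<open>Coordinates below \<open>m\<close> hold \<open>y\<close>, those from
    \<open>m\<close> to t - 1 hold the table \<open>q\<close> indexed through \<open>e\<close>, and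
    coordinate \<open>t\<close> separates the affine part from the stars.\<close>
  define t where "t = m + 2 ^ m"
  define trunc :: "f2vec \<Rightarrow> f2vec" where "trunc v = (\<lambda>i. if i < m then v i else 0)" for v
  define A :: pattern where
    "A = (\<lambda>v. Some (if v t = 0 then Star else Val (v (m + e (trunc v))))) |` std_space (Suc t)"
  have dom: "dom A = std_space (Suc t)"
    by (auto simp: A_def restrict_map_def split: if_splits)
  have last: "v \<in> vecs (Suc t) \<and> v t = 0 \<longleftrightarrow> v \<in> vecs t" for v
    unfolding vecs_def mem_Collect_eq by (metis Suc_leD Suc_leI le_neq_implies_less order_refl)
  have star: "{x. A x = Some Star} = std_space t"
  proof -
    have "A v = Some Star \<longleftrightarrow> v \<in> std_space (Suc t) \<and> v t = 0" for v
      by (simp add: A_def restrict_map_def)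
    thus ?thesis
      using last unfolding std_space_eq by blast
  qed
  have "std_space t \<subseteq> std_space (Suc t)"
    using last unfolding std_space_eq by blast
  hence "affine_pattern A"
    unfolding affine_pattern_def k_affine_def is_pattern_def proj_subspace_def codim_def dom star
    by (simp add: proj_space_std_space pdim_std_space)
  moreover have sub: "vecs m \<subseteq> vecs (Suc t)"
    by (auto simp: vecs_def t_def)
  moreover have "\<exists>x\<in>vecs (Suc t). x \<notin> vecs m \<and> (\<forall>u\<in>vecs m. A (x + u) = Some (Val (p u)))" for p
  proof -
    define x :: f2vec where "x = (\<lambda>i. if i = t then 1 else
      if m \<le> i \<and> i < t then p (inv_into (vecs m) e (i - m)) else 0)"
    have x: "x \<in> vecs (Suc t)" "x \<notin> vecs m"
      by (auto simp: x_def vecs_def t_def)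
    have "A (x + u) = Some (Val (p u))" if u: "u \<in> vecs m" for u
    proof -
      have u0: "u i = 0" if "i \<ge> m" for i
        using u that by (simp add: vecs_def)
      have xt: "(x + u) t = 1"
        using u0[of t] by (simp add: x_def t_def)
      have "x + u \<in> vecs (Suc t)"
        using x(1) u sub f2_subspace_vecs[of "Suc t"] unfolding f2_subspace_iff by blast
      moreover have "x + u \<noteq> 0"
      proof
        assume "x + u = 0"
        thus False
          using xt by (simp only: zero_fun_apply zero_neq_one)
      qed
      moreover have "trunc (x + u) = u"
        using u0 by (auto simp: trunc_def x_def t_def fun_eq_iff)
      moreover have "(x + u) (m + e u) = p u"
        using u0[of "m + e u"] e[OF u] u by (simp add: x_def t_def)
      ultimately show ?thesis
        using xt by (simp add: A_def std_space_eq)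
    qed
    thus ?thesis
      using x by blast
  qed
  ultimately show ?thesis
    using dom by (intro that[of A "Suc t"])
qed

text \<open>The universal pattern for the Ramsey dimension \<open>m\<close> would occur in some
  member of \<open>T\<close>. Ramsey inside \<open>vecs m\<close> gives a subspace of some value
  \<open>i\<close> to hold the hyperplane of \<open>N i\<close>, and universality gives a coset with
  the remaining values of \<open>N i\<close>; together they put \<open>N i\<close> into
  \<open>T\<close>.\<close>

lemma free_if_not_ext_const_subset:
  assumes T: "matroid_property T" "hereditary T" and not_sub: "\<And>i. \<not> ext_const 1 i \<subseteq> T"
  shows "\<exists>A. affine_pattern A \<and> (\<forall>M\<in>T. pattern_free A M)"
proof (rule ccontr)
  assume no_pattern: "\<not> ?thesis"
  have "\<forall>i. \<exists>N. N \<in> ext_const 1 i \<and> N \<notin> T"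
    using not_sub by blast
  then obtain N where N: "\<And>i. N i \<in> ext_const 1 i" "\<And>i. N i \<notin> T"
    by metis
  have V: "proj_space (dom (N i))" for i
    using N(1)[of i] by (simp add: ext_const_iff is_matroid_def)
  define d where "d = pdim (dom (N 0)) + pdim (dom (N 1))"
  have d: "pdim (dom (N i)) \<le> d" for i
    by (cases i) (simp_all add: d_def)
  obtain m where m: "\<And>M :: matroid. std_space m \<subseteq> dom M \<Longrightarrow>
      \<exists>D i. D \<subseteq> vecs m \<and> f2.subspace D \<and> card D = 2 ^ d \<and> (\<forall>x\<in>D - {0}. M x = Some i)"
    using matroid_Ramsey by blast
  obtain A n where A: "affine_pattern A" "dom A = std_space n" "vecs m \<subseteq> vecs n"
      and univ: "\<And>p. \<exists>x\<in>vecs n. x \<notin> vecs m \<and> (\<forall>u\<in>vecs m. A (x + u) = Some (Val (p u)))"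
    using universal_affine_pattern by metis
  obtain M0 \<theta> where M0: "M0 \<in> T" and \<theta>: "is_instance A M0 \<theta>"
    using no_pattern A(1) unfolding pattern_free_def by blast
  \<comment> \<open>Pulling back along the instance makes the pattern appear in place:
    \<open>M\<close> agrees with \<open>A\<close> wherever \<open>A\<close> has a value 0 or
    1.\<close>
  define M where "M = (M0 \<circ> \<theta>) |` std_space n"
  have M: "M \<in> T" "dom M = std_space n"
    using pullback_in_property[OF T M0 proj_space_std_space] \<theta>
    unfolding M_def is_instance_def A(2) by blast+
  have MA: "M v = Some b" if "A v = Some (Val b)" for v b
  proof -
    have "v \<in> std_space n"
      using that A(2) by blast
    thus ?thesis
      using \<theta> that by (simp add: M_def is_instance_def)
  qed
  have "std_space m \<subseteq> dom M"
    unfolding M(2) using A(3) by (auto simp: std_space_eq)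
  then obtain D i where D: "D \<subseteq> vecs m" "f2.subspace D" "card D = 2 ^ d"
      and i: "\<forall>x\<in>D - {0}. M x = Some i"
    using m by blast
  obtain U where U: "proj_subspace U (dom (N i))" "codim U (dom (N i)) \<le> 1" "\<forall>x\<in>U. N i x = Some i"
    using N(1)[of i] unfolding ext_const_iff by blast
  have projU: "proj_space U" and subU: "U \<subseteq> dom (N i)"
    using U(1) unfolding proj_subspace_def by simp_all
  let ?H = "insert 0 U"
  have H: "f2.subspace ?H" "finite ?H"
    using projU by (simp_all add: proj_space_iff)
  obtain a where a: "a \<notin> ?H" "insert 0 (dom (N i)) \<subseteq> ?H \<union> (+) a ` ?H"
    using codim_le_1_cover[OF U(1) V U(2)] by metis
  have "pdim U \<le> d"
    using pdim_mono[OF projU V subU] d[of i] by simp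
  hence "card ?H \<le> card D"
    using projU by (simp add: card_proj_space D(3))
  then obtain \<phi> where \<phi>: "additive_inj_on \<phi> ?H" "\<phi> ` ?H \<subseteq> D"
    using ex_additive_inj_on[OF H D(2)] finite_subset[OF D(1) finite_vecs] by blast
  \<comment> \<open>Transports the values of \<open>N i\<close> on a + U along \<phi>. Where
    \<open>N i\<close> is undefined, as happens on this coset in codimension 0, the value of
    \<open>p\<close> is arbitrary; the final comparison covers only the domain of
    \<open>N i\<close>.\<close>
  define p where "p u = the (N i (a + inv_into ?H \<phi> u))" for u
  obtain x where x: "x \<in> vecs n" "x \<notin> vecs m" "\<forall>u\<in>vecs m. A (x + u) = Some (Val (p u))"
    using univ by blast
  have "x \<notin> \<phi> ` ?H"
    using x(2) \<phi>(2) D(1) by blast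
  then obtain \<psi> where \<psi>: "additive_inj_on \<psi> (?H \<union> (+) a ` ?H)" "\<And>u. u \<in> ?H \<Longrightarrow> \<psi> u = \<phi> u"
      "\<And>u. u \<in> ?H \<Longrightarrow> \<psi> (a + u) = x + \<phi> u"
    using additive_inj_on_double[OF \<phi>(1) H(1) a(1)] by metis
  have \<phi>m: "\<phi> u \<in> vecs m" if "u \<in> ?H" for u
    using \<phi>(2) D(1) that by blast
  have "x + w \<in> vecs n" if "w \<in> vecs m" for w
    using x(1) A(3) that f2_subspace_vecs[of n] unfolding f2_subspace_iff by blast
  hence "\<psi> u \<in> vecs n \<and> \<psi> (a + u) \<in> vecs n" if "u \<in> ?H" for u
    unfolding \<psi>(2)[OF that] \<psi>(3)[OF that] using \<phi>m[OF that] A(3) by blast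
  hence im: "\<psi> ` (?H \<union> (+) a ` ?H) \<subseteq> vecs n"
    by blast
  have N0: "0 \<notin> dom (N i)"
    using V[of i] by (simp add: proj_space_iff)
  have inj: "linear_injection \<psi> (dom (N i)) (dom M)"
  proof (rule linear_injectionI_subspace[OF \<psi>(1) a(2) N0])
    show "\<psi> ` dom (N i) \<subseteq> insert 0 (dom M)"
      using im a(2) unfolding M(2) insert_0_std_space by blast
  qed
  have "N i \<in> T"
  proof (rule matroid_property_pullback[OF T M(1) _ inj])
    show "is_matroid (N i)"
      using V by (simp add: is_matroid_def)
    fix v assume v: "v \<in> dom (N i)"
    hence "v \<in> ?H \<union> (+) a ` ?H" "v \<noteq> 0"
      using a(2) N0 by blast+
    then consider "v \<in> U" | u where "u \<in> ?H" "v = a + u"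
      by blast
    thus "N i v = M (\<psi> v)"
    proof cases
      case 1
      hence "\<psi> v = \<phi> v" "\<phi> v \<in> D"
        using \<psi>(2) \<phi>(2) by blast+
      moreover have "\<psi> v \<in> dom M"
        using linear_injectionD(2)[OF inj N0] v by blast
      hence "\<psi> v \<noteq> 0"
        by (auto simp: M(2) std_space_eq simp del: domIff)
      ultimately have "M (\<psi> v) = Some i"
        using i by simp
      thus ?thesis
        using U(3) 1 by simp
    next
      case 2
      have "inv_into ?H \<phi> (\<phi> u) = u"
        using \<phi>(1) 2(1) unfolding additive_inj_on_def by (intro inv_into_f_f) auto
      hence "Some (p (\<phi> u)) = N i v"
        using v 2(2) by (auto simp: p_def)
      moreover have "M (\<psi> v) = Some (p (\<phi> u))"
        unfolding 2(2) \<psi>(3)[OF 2(1)] using x(3) \<phi>m[OF 2(1)] by (intro MA) blast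
      ultimately show ?thesis
        by simp
    qed
  qed
  thus False
    using N(2) by blast
qed

theorem theorem1p7:
  fixes T :: "matroid set"
  assumes "matroid_property T" and "hereditary T" and "nontrivial T"
  shows "(thin T \<longleftrightarrow> (\<exists>A. affine_pattern A \<and> (\<forall>M\<in>T. pattern_free A M))) \<and>
    ((\<exists>A. affine_pattern A \<and> (\<forall>M\<in>T. pattern_free A M)) \<longleftrightarrow>
      (\<lambda>n. h n T) \<in> o(\<lambda>n. 2 ^ n))"
proof -
  \<comment> \<open>The maximum has to be attained: the constant matroids of one value supply k = 0,
    and the assumption excludes every larger \<open>k\<close>.\<close>
  have thinI: "thin T" if "\<And>k i. k \<ge> 1 \<Longrightarrow> \<not> ext_const k i \<subseteq> T"
    unfolding thin_def is_critical_number_def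
    using const_matroids_subset_property[OF assms] that by (metis less_one not_le_imp_less order_refl)
  have thinD: "\<not> ext_const 1 i \<subseteq> T" if "thin T" for i
    using that unfolding thin_def is_critical_number_def by fastforce
  have ab: "thin T \<Longrightarrow> \<exists>A. affine_pattern A \<and> (\<forall>M\<in>T. pattern_free A M)"
    using free_if_not_ext_const_subset[OF assms(1,2)] thinD by blast
  have ba: "\<exists>A. affine_pattern A \<and> (\<forall>M\<in>T. pattern_free A M) \<Longrightarrow> thin T"
    using not_ext_const_subset_if_free thinI by blast
  have bc: "\<exists>A. affine_pattern A \<and> (\<forall>M\<in>T. pattern_free A M) \<Longrightarrow> (\<lambda>n. h n T) \<in> o(\<lambda>n. 2 ^ n)"
    using h_small_if_free by blast
  have ca: "(\<lambda>n. h n T) \<in> o(\<lambda>n. 2 ^ n) \<Longrightarrow> thin T"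
    using not_ext_const_subset_if_h_small thinI by blast
  show ?thesis
    using ab ba bc ca by argo
qed

end
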